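(* Let $n$ be a positive integer, let $\boldsymbol{X}=(X_{i,j})_{i,j\in[2n]}$ with $X_{i,j}=E_{i,j}-E_{-j,-i}\in\mathfrak{o}_{2n}\subset U(\mathfrak{o}_{2n})$, where $-i$ stands for the index $2n+1-i$, and let $\operatorname{Pf}(\boldsymbol X)\in ZU(\mathfrak{o}_{2n})$ be the associated Pfaffian. On the irreducible representation of $\mathfrak{o}_{2n}$ with highest weight $\lambda=\sum_{i=1}^n\lambda_i\epsilon_i$, the eigenvalue of the central element $\operatorname{Pf}(\boldsymbol X)$ is $$\prod_{i=1}^n(\lambda_i+n-i).$$
   Context: Notation. $[m]=\{1,\dots,m\}$. Row and column indices of $2n\times 2n$ matrices lie in $[2n]$, and $-i$ stands for $2n+1-i$. $E_{i,j}$ is the $2n\times2n$ matrix unit. $J_{2n}$ is the $2n\times 2n$ matrix with $1$'s on the anti-diagonal and $0$'s elsewhere; $\mathfrak{o}_{2n}=\{X\in\mathrm{Mat}_{2n}(\mathbb{C}):{}^tXJ_{2n}+J_{2n}X=0\}$, with universal enveloping algebra $U(\mathfrak o_{2n})$ and center $ZU(\mathfrak o_{2n})$. $\operatorname{Pf}(\boldsymbol X)$ is the Pfaffian of the alternating matrix $\tilde{\boldsymbol X}=\boldsymbol XJ_{2n}$, whose $(i,j)$ entry is $\tilde X_{i,j}=X_{i,-j}$, i.e. $$\operatorname{Pf}(\boldsymbol X)=\frac1{2^nn!}\sum_{\sigma\in\mathfrak S_{2n}}\operatorname{sgn}(\sigma)\tilde X_{\sigma(1),\sigma(2)}\tilde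 X_{\sigma(3),\sigma(4)}\cdots\tilde X_{\sigma(2n-1),\sigma(2n)}\in U(\mathfrak o_{2n});$$ it lies in $ZU(\mathfrak o_{2n})$. The Cartan subalgebra is the space $\mathfrak h$ of diagonal matrices in $\mathfrak o_{2n}$, $\mathfrak h=\bigoplus_{i\in[n]}\mathbb{C}X_{i,i}$, and $\epsilon_i\in\mathfrak h^*$ takes $\operatorname{diag}(h_1,\dots,h_n,-h_n,\dots,-h_1)$ to $h_i$. The positive roots are $\epsilon_i-\epsilon_j$ and $\epsilon_i+\epsilon_j$ for $1\le i<j\le n$, with root vectors $X_{i,j}$ and $X_{i,-j}$ respectively (these span the strictly upper triangular matrices in $\mathfrak o_{2n}$). Highest weights are taken with respect to this positive system. *)

theory Defs
  imports
    "Jordan_Normal_Form.Matrix"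
    "HOL-Algebra.QuotRing"
    "HOL-Library.Poly_Mapping"
    "HOL-Combinatorics.Permutations"
begin

section \<open>The orthogonal Lie algebra\<close>

text \<open>
  Row and column indices range over \<open>1, \<dots>, 2n\<close>, whereas the entries of a \<open>mat\<close> are
  counted from \<open>0\<close>, whence the shifts below.  \<open>neg n i\<close> is the index written \<open>-i\<close>.
\<close>

definition neg :: "nat \<Rightarrow> nat \<Rightarrow> nat" where
  "neg n i = 2 * n + 1 - i"

definition E :: "nat \<Rightarrow> nat \<Rightarrow> nat \<Rightarrow> complex mat" where
  "E n i j = mat (2 * n) (2 * n) (\<lambda>(a, b). if a + 1 = i \<and> b + 1 = j then 1 else 0)"

definition J :: "nat \<Rightarrow> complex mat" where
  "J n = mat (2 * n) (2 * n) (\<lambda>(a, b). if b + 1 = neg n (a + 1) then 1 else 0)"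

definition orth :: "nat \<Rightarrow> complex mat set" where
  "orth n = {x \<in> carrier_mat (2 * n) (2 * n).
     transpose_mat x * J n + J n * x = 0\<^sub>m (2 * n) (2 * n)}"

definition bracket :: "complex mat \<Rightarrow> complex mat \<Rightarrow> complex mat" where
  "bracket x y = x * y - y * x"

definition X :: "nat \<Rightarrow> nat \<Rightarrow> nat \<Rightarrow> complex mat" where
  "X n i j = E n i j - E n (neg n j) (neg n i)"

definition cartan :: "nat \<Rightarrow> complex mat set" where
  "cartan n = {h \<in> orth n. diagonal_mat h}"

definition eps :: "nat \<Rightarrow> complex mat \<Rightarrow> complex" where
  "eps i h = h $$ (i - 1, i - 1)"

definition positive_root_vectors :: "nat \<Rightarrow> complex mat set" where
  "positive_root_vectors n =
     {X n i j | i j. 1 \<le> i \<and> i < j \<and> j \<le> n} \<union>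
     {X n i (neg n j) | i j. 1 \<le> i \<and> i < j \<and> j \<le> n}"


section \<open>The universal enveloping algebra\<close>

text \<open>
  Words form a monoid under concatenation, so that \<open>'a list \<Rightarrow>\<^sub>0 complex\<close> with the
  convolution product is the free associative unital algebra on \<open>'a\<close>.
\<close>

instantiation list :: (type) monoid_add
begin
definition zero_list :: "'a list" where "zero_list = []"
definition plus_list :: "'a list \<Rightarrow> 'a list \<Rightarrow> 'a list" where "plus_list u w = u @ w"
instance by standard (simp_all add: zero_list_def plus_list_def)
end

type_synonym free = "complex mat list \<Rightarrow>\<^sub>0 complex"

definition const :: "complex \<Rightarrow> free" where
  "const c = Poly_Mapping.single [] c"

definition gen :: "complex mat \<Rightarrow> free" where
  "gen x = Poly_Mapping.single [x] 1"

definition free_alg :: "nat \<Rightarrow> free ring" where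
  "free_alg n = \<lparr>carrier = {p. Poly_Mapping.keys p \<subseteq> lists (orth n)},
     mult = (*), one = 1, zero = 0, add = (+)\<rparr>"

text \<open>
  The free algebra lives on the underlying set of \<open>orth n\<close>, so the first two families of
  relations, which make \<open>x \<mapsto> gen x\<close> linear, are needed besides the commutator relations.
\<close>

definition uea_relations :: "nat \<Rightarrow> free set" where
  "uea_relations n =
     {gen (x + y) - (gen x + gen y) | x y. x \<in> orth n \<and> y \<in> orth n} \<union>
     {gen (c \<cdot>\<^sub>m x) - const c * gen x | c x. x \<in> orth n} \<union>
     {gen (bracket x y) - (gen x * gen y - gen y * gen x) | x y. x \<in> orth n \<and> y \<in> orth n}"

definition uea_ideal :: "nat \<Rightarrow> free set" where
  "uea_ideal n = genideal (free_alg n) (uea_relations n)"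

definition uea :: "nat \<Rightarrow> free set ring" where
  "uea n = free_alg n Quot uea_ideal n"

definition uea_class :: "nat \<Rightarrow> free \<Rightarrow> free set" where
  "uea_class n p = uea_ideal n +>\<^bsub>free_alg n\<^esub> p"

definition uea_emb :: "nat \<Rightarrow> complex mat \<Rightarrow> free set" where
  "uea_emb n x = uea_class n (gen x)"

definition uea_smult :: "nat \<Rightarrow> complex \<Rightarrow> free set \<Rightarrow> free set" where
  "uea_smult n c u = uea_class n (const c) \<otimes>\<^bsub>uea n\<^esub> u"

definition uea_center :: "nat \<Rightarrow> free set set" where
  "uea_center n = {z \<in> carrier (uea n).
     \<forall>u \<in> carrier (uea n). z \<otimes>\<^bsub>uea n\<^esub> u = u \<otimes>\<^bsub>uea n\<^esub> z}"


section \<open>The Pfaffian\<close>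

definition pfaffian :: "nat \<Rightarrow> (nat \<Rightarrow> nat \<Rightarrow> free set) \<Rightarrow> free set" where
  "pfaffian n A = uea_smult n (1 / (2 ^ n * fact n))
     (\<Oplus>\<^bsub>uea n\<^esub>\<sigma>\<in>{\<sigma>. \<sigma> permutes {1..2 * n}}.
        uea_smult n (of_int (sign \<sigma>))
          (foldr (\<lambda>k u. A (\<sigma> (2 * k - 1)) (\<sigma> (2 * k)) \<otimes>\<^bsub>uea n\<^esub> u) [1..<n + 1] \<one>\<^bsub>uea n\<^esub>))"

definition Pf_X :: "nat \<Rightarrow> free set" where
  "Pf_X n = pfaffian n (\<lambda>i j. uea_emb n (X n i (neg n j)))"


section \<open>Representations\<close>

text \<open>A representation of \<open>orth n\<close> on the complex vector space \<open>'v\<close> (of any dimension).\<close>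

definition orth_rep ::
  "nat \<Rightarrow> (complex \<Rightarrow> 'v::ab_group_add \<Rightarrow> 'v) \<Rightarrow> (complex mat \<Rightarrow> 'v \<Rightarrow> 'v) \<Rightarrow> bool" where
  "orth_rep n scale \<rho> \<longleftrightarrow>
     vector_space scale \<and>
     (\<forall>x\<in>orth n. Vector_Spaces.linear scale scale (\<rho> x)) \<and>
     (\<forall>x\<in>orth n. \<forall>y\<in>orth n. \<forall>v. \<rho> (x + y) v = \<rho> x v + \<rho> y v) \<and>
     (\<forall>c. \<forall>x\<in>orth n. \<forall>v. \<rho> (c \<cdot>\<^sub>m x) v = scale c (\<rho> x v)) \<and>
     (\<forall>x\<in>orth n. \<forall>y\<in>orth n. \<forall>v. \<rho> (bracket x y) v = \<rho> x (\<rho> y v) - \<rho> y (\<rho> x v))"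

definition irreducible_orth_rep ::
  "nat \<Rightarrow> (complex \<Rightarrow> 'v::ab_group_add \<Rightarrow> 'v) \<Rightarrow> (complex mat \<Rightarrow> 'v \<Rightarrow> 'v) \<Rightarrow> bool" where
  "irreducible_orth_rep n scale \<rho> \<longleftrightarrow>
     orth_rep n scale \<rho> \<and> (\<exists>v::'v. v \<noteq> 0) \<and>
     (\<forall>W. module.subspace scale W \<and> (\<forall>x\<in>orth n. \<rho> x ` W \<subseteq> W) \<longrightarrow> W = {0} \<or> W = UNIV)"

text \<open>
  \<open>\<Lambda>\<close> is a functional on the Cartan subalgebra.  In an irreducible representation a highest
  weight vector automatically generates, so generation is not demanded here.
\<close>

definition has_highest_weight ::
  "nat \<Rightarrow> (complex \<Rightarrow> 'v::ab_group_add \<Rightarrow> 'v) \<Rightarrow> (complex mat \<Rightarrow> 'v \<Rightarrow> 'v) \<Rightarrow>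
   (complex mat \<Rightarrow> complex) \<Rightarrow> bool" where
  "has_highest_weight n scale \<rho> \<Lambda> \<longleftrightarrow>
     (\<exists>v. v \<noteq> 0 \<and> (\<forall>h\<in>cartan n. \<rho> h v = scale (\<Lambda> h) v) \<and>
          (\<forall>x\<in>positive_root_vectors n. \<rho> x v = 0))"

definition free_act ::
  "(complex \<Rightarrow> 'v::ab_group_add \<Rightarrow> 'v) \<Rightarrow> (complex mat \<Rightarrow> 'v \<Rightarrow> 'v) \<Rightarrow> free \<Rightarrow> 'v \<Rightarrow> 'v" where
  "free_act scale \<rho> p v =
     (\<Sum>w\<in>Poly_Mapping.keys p. scale (Poly_Mapping.lookup p w) (foldr \<rho> w v))"

text \<open>
  The action of the enveloping algebra extending \<open>\<rho>\<close>: all representatives of a coset act in the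
  same way, as shown in \<open>uea_act_class\<close> below.
\<close>

definition uea_act ::
  "(complex \<Rightarrow> 'v::ab_group_add \<Rightarrow> 'v) \<Rightarrow> (complex mat \<Rightarrow> 'v \<Rightarrow> 'v) \<Rightarrow> free set \<Rightarrow> 'v \<Rightarrow> 'v" where
  "uea_act scale \<rho> u = the_elem (free_act scale \<rho> ` u)"


section \<open>Well-definedness\<close>

lemma free_decomp: "p = (\<Sum>w\<in>Poly_Mapping.keys p. Poly_Mapping.single w (Poly_Mapping.lookup p w))"
  for p :: "'a \<Rightarrow>\<^sub>0 'b::comm_monoid_add"
  by (rule poly_mapping_eqI)
    (auto simp: lookup_sum lookup_single when_def sum.delta in_keys_iff)

lemma keys_mult_lists:
  assumes "Poly_Mapping.keys p \<subseteq> lists A" "Poly_Mapping.keys q \<subseteq> lists A"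
  shows "Poly_Mapping.keys (p * q :: free) \<subseteq> lists A"
  using keys_mult[of p q] assms by (fastforce simp: plus_list_def)

lemma ring_free_alg: "ring (free_alg n)"
proof (rule ringI)
  show "abelian_group (free_alg n)"
  proof (rule abelian_groupI)
    fix p assume "p \<in> carrier (free_alg n)"
    then show "\<exists>q\<in>carrier (free_alg n). q \<oplus>\<^bsub>free_alg n\<^esub> p = \<zero>\<^bsub>free_alg n\<^esub>"
      by (intro bexI[of _ "- p"]) (auto simp: free_alg_def)
  next
    fix p q assume "p \<in> carrier (free_alg n)" "q \<in> carrier (free_alg n)"
    then show "p \<oplus>\<^bsub>free_alg n\<^esub> q \<in> carrier (free_alg n)"
      using Poly_Mapping.keys_add[of p q] by (auto simp: free_alg_def)
  qed (auto simp: free_alg_def algebra_simps)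
  show "Group.monoid (free_alg n)"
  proof (rule monoidI)
    fix p q assume "p \<in> carrier (free_alg n)" "q \<in> carrier (free_alg n)"
    then show "p \<otimes>\<^bsub>free_alg n\<^esub> q \<in> carrier (free_alg n)"
      using keys_mult_lists[of p "orth n" q] by (simp add: free_alg_def)
  qed (auto simp: free_alg_def algebra_simps zero_list_def)
qed (auto simp: free_alg_def algebra_simps)

lemma orth_iff:
  "x \<in> orth n \<longleftrightarrow> x \<in> carrier_mat (2 * n) (2 * n) \<and>
     (\<forall>a<2 * n. \<forall>b<2 * n. x $$ (2 * n - Suc b, a) = - x $$ (2 * n - Suc a, b))"
proof (cases "x \<in> carrier_mat (2 * n) (2 * n)")
  case x: True
  have J: "J n \<in> carrier_mat (2 * n) (2 * n)" by (simp add: J_def)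
  have 1: "(transpose_mat x * J n) $$ (a, b) = x $$ (2 * n - Suc b, a)"
    if "a < 2 * n" "b < 2 * n" for a b
  proof -
    have "(transpose_mat x * J n) $$ (a, b) =
        (\<Sum>k<2 * n. x $$ (k, a) * (if b + 1 = neg n (k + 1) then 1 else 0))"
      using x that by (simp add: scalar_prod_def J_def lessThan_atLeast0)
    also have "\<dots> = (\<Sum>k<2 * n. if k = 2 * n - Suc b then x $$ (k, a) else 0)"
      using that by (intro sum.cong) (auto simp: neg_def)
    finally show ?thesis using that by simp
  qed
  have 2: "(J n * x) $$ (a, b) = x $$ (2 * n - Suc a, b)"
    if "a < 2 * n" "b < 2 * n" for a b
  proof -
    have "(J n * x) $$ (a, b) =
        (\<Sum>k<2 * n. (if k + 1 = neg n (a + 1) then 1 else 0) * x $$ (k, b))"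
      using x that by (simp add: scalar_prod_def J_def lessThan_atLeast0)
    also have "\<dots> = (\<Sum>k<2 * n. if k = 2 * n - Suc a then x $$ (k, b) else 0)"
      using that by (intro sum.cong) (auto simp: neg_def)
    finally show ?thesis using that by simp
  qed
  have "x \<in> orth n \<longleftrightarrow> (\<forall>a<2 * n. \<forall>b<2 * n.
      (transpose_mat x * J n + J n * x) $$ (a, b) = 0)"
  proof
    assume "x \<in> orth n"
    then have "transpose_mat x * J n + J n * x = 0\<^sub>m (2 * n) (2 * n)" by (simp add: orth_def)
    then show "\<forall>a<2 * n. \<forall>b<2 * n. (transpose_mat x * J n + J n * x) $$ (a, b) = 0"
      by (simp only:) simp
  next
    assume "\<forall>a<2 * n. \<forall>b<2 * n. (transpose_mat x * J n + J n * x) $$ (a, b) = 0"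
    then have "transpose_mat x * J n + J n * x = 0\<^sub>m (2 * n) (2 * n)"
      using x J by (intro eq_matI) (simp_all del: index_mult_mat(1) index_add_mat(1))
    then show "x \<in> orth n" using x by (simp add: orth_def)
  qed
  also have "\<dots> \<longleftrightarrow> (\<forall>a<2 * n. \<forall>b<2 * n.
      x $$ (2 * n - Suc b, a) + x $$ (2 * n - Suc a, b) = 0)"
  proof -
    have "(transpose_mat x * J n + J n * x) $$ (a, b) =
        x $$ (2 * n - Suc b, a) + x $$ (2 * n - Suc a, b)" if "a < 2 * n" "b < 2 * n" for a b
      using x J that 1[OF that] 2[OF that] by (simp del: index_mult_mat(1))
    then show ?thesis by simp
  qed
  finally show ?thesis using x by (simp add: eq_neg_iff_add_eq_0)
qed (simp add: orth_def)

lemma orthI: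
  assumes "x \<in> carrier_mat (2 * n) (2 * n)"
    and "\<And>a b. a < 2 * n \<Longrightarrow> b < 2 * n \<Longrightarrow> x $$ (2 * n - Suc b, a) = - x $$ (2 * n - Suc a, b)"
  shows "x \<in> orth n"
  using assms unfolding orth_iff by blast

lemma orthD:
  assumes "x \<in> orth n" "a < 2 * n" "b < 2 * n"
  shows "x $$ (2 * n - Suc b, a) = - x $$ (2 * n - Suc a, b)"
  using assms unfolding orth_iff by blast

lemma orth_carrier: "x \<in> orth n \<Longrightarrow> x \<in> carrier_mat (2 * n) (2 * n)"
  by (simp add: orth_def)

lemma X_closed:
  assumes "i \<in> {1..2 * n}" "j \<in> {1..2 * n}"
  shows "X n i j \<in> orth n"
proof (rule orthI)
  show "X n i j \<in> carrier_mat (2 * n) (2 * n)"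
    by (simp add: X_def E_def minus_carrier_mat)
  fix a b assume ab: "a < 2 * n" "b < 2 * n"
  have X: "X n i j $$ (c, d) = (if c + 1 = i \<and> d + 1 = j then 1 else 0) -
      (if c + 1 = neg n j \<and> d + 1 = neg n i then 1 else 0)" if "c < 2 * n" "d < 2 * n" for c d
    using that by (simp add: X_def E_def)
  have "2 * n - Suc b + 1 = i \<and> a + 1 = j \<longleftrightarrow> 2 * n - Suc a + 1 = neg n j \<and> b + 1 = neg n i"
    "2 * n - Suc b + 1 = neg n j \<and> a + 1 = neg n i \<longleftrightarrow> 2 * n - Suc a + 1 = i \<and> b + 1 = j"
    using assms ab unfolding neg_def atLeastAtMost_iff by linarith+
  moreover have "2 * n - Suc a < 2 * n" "2 * n - Suc b < 2 * n" using ab by auto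
  ultimately show "X n i j $$ (2 * n - Suc b, a) = - X n i j $$ (2 * n - Suc a, b)"
    using ab by (simp only: X) simp
qed

lemma orth_add:
  assumes "x \<in> orth n" "y \<in> orth n"
  shows "x + y \<in> orth n"
proof (rule orthI)
  note car = assms[THEN orth_carrier]
  then show "x + y \<in> carrier_mat (2 * n) (2 * n)" by simp
  fix a b assume "a < 2 * n" "b < 2 * n"
  then show "(x + y) $$ (2 * n - Suc b, a) = - (x + y) $$ (2 * n - Suc a, b)"
    using car orthD[OF assms(1), of a b] orthD[OF assms(2), of a b] by simp
qed

lemma orth_smult:
  assumes "x \<in> orth n"
  shows "c \<cdot>\<^sub>m x \<in> orth n"
proof (rule orthI)
  note car = assms[THEN orth_carrier]
  then show "c \<cdot>\<^sub>m x \<in> carrier_mat (2 * n) (2 * n)" by simp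
  fix a b assume "a < 2 * n" "b < 2 * n"
  then show "(c \<cdot>\<^sub>m x) $$ (2 * n - Suc b, a) = - (c \<cdot>\<^sub>m x) $$ (2 * n - Suc a, b)"
    using car orthD[OF assms, of a b] by simp
qed

lemma orth_bracket:
  assumes "x \<in> orth n" "y \<in> orth n"
  shows "bracket x y \<in> orth n"
proof -
  have car: "x \<in> carrier_mat (2 * n) (2 * n)" "y \<in> carrier_mat (2 * n) (2 * n)"
    using assms by (auto dest: orth_carrier)
  have flip: "z $$ (i, j) = - z $$ (2 * n - Suc j, 2 * n - Suc i)"
    if "z \<in> orth n" "i < 2 * n" "j < 2 * n" for z i j
  proof -
    have "z $$ (2 * n - Suc (2 * n - Suc i), j) = - z $$ (2 * n - Suc j, 2 * n - Suc i)"
      using that by (intro orthD) auto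
    moreover have "2 * n - Suc (2 * n - Suc i) = i" using that by simp
    ultimately show ?thesis by simp
  qed
  have key: "(z * w) $$ (2 * n - Suc b, a) = (w * z) $$ (2 * n - Suc a, b)"
    if "a < 2 * n" "b < 2 * n" "z \<in> orth n" "w \<in> orth n" for a b z w
  proof -
    have c: "z \<in> carrier_mat (2 * n) (2 * n)" "w \<in> carrier_mat (2 * n) (2 * n)"
      using that by (auto dest: orth_carrier)
    have "(z * w) $$ (2 * n - Suc b, a) = (\<Sum>k<2 * n. z $$ (2 * n - Suc b, k) * w $$ (k, a))"
      using c that by (simp add: scalar_prod_def lessThan_atLeast0)
    also have "\<dots> = (\<Sum>k<2 * n. w $$ (2 * n - Suc a, 2 * n - Suc k) * z $$ (2 * n - Suc k, b))"
    proof (rule sum.cong)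
      fix k assume k: "k \<in> {..<2 * n}"
      then show "z $$ (2 * n - Suc b, k) * w $$ (k, a) =
          w $$ (2 * n - Suc a, 2 * n - Suc k) * z $$ (2 * n - Suc k, b)"
        using flip[OF that(3), of "2 * n - Suc b" k] flip[OF that(4), of k a] that(1,2)
        by (simp add: Suc_diff_Suc mult.commute)
    qed simp
    also have "\<dots> = (\<Sum>k<2 * n. w $$ (2 * n - Suc a, k) * z $$ (k, b))"
      by (rule sum.nat_diff_reindex)
    finally show ?thesis
      using c that by (simp add: scalar_prod_def lessThan_atLeast0)
  qed
  show ?thesis
  proof (rule orthI)
    fix a b assume "a < 2 * n" "b < 2 * n"
    then show "bracket x y $$ (2 * n - Suc b, a) = - bracket x y $$ (2 * n - Suc a, b)"
      using car key[OF _ _ assms, of a b] key[OF _ _ assms(2,1), of a b]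
      by (simp add: bracket_def del: index_mult_mat(1))
  qed (use car in \<open>simp add: bracket_def minus_carrier_mat\<close>)
qed

lemma gen_closed: "x \<in> orth n \<Longrightarrow> gen x \<in> carrier (free_alg n)"
  by (simp add: gen_def free_alg_def)

lemma const_closed: "const c \<in> carrier (free_alg n)"
  by (auto simp: const_def free_alg_def)

lemma free_closed:
  assumes "p \<in> carrier (free_alg n)" "q \<in> carrier (free_alg n)"
  shows "p + q \<in> carrier (free_alg n)" "p - q \<in> carrier (free_alg n)"
    "p * q \<in> carrier (free_alg n)"
  using assms Poly_Mapping.keys_add[of p q] keys_diff[of p q] keys_mult_lists[of p "orth n" q]
  by (auto simp: free_alg_def)

lemma uea_relations_closed: "uea_relations n \<subseteq> carrier (free_alg n)"
  unfolding uea_relations_def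
  by (auto intro!: free_closed gen_closed const_closed orth_add orth_smult orth_bracket)

lemma ideal_uea_ideal: "ideal (uea_ideal n) (free_alg n)"
  unfolding uea_ideal_def by (rule ring.genideal_ideal[OF ring_free_alg uea_relations_closed])

lemma ideal_abelian_subgroup: "abelian_subgroup (uea_ideal n) (free_alg n)"
  using ideal_uea_ideal ideal.axioms(1) ring_free_alg
  by (intro abelian_subgroupI3) (auto simp: ring.is_abelian_group)

lemma ring_uea: "ring (uea n)"
  unfolding uea_def by (rule ideal.quotient_is_ring[OF ideal_uea_ideal])

lemma uea_class_closed: "p \<in> carrier (free_alg n) \<Longrightarrow> uea_class n p \<in> carrier (uea n)"
  by (auto simp: uea_class_def uea_def FactRing_def A_RCOSETS_def')

context
  fixes n :: nat and scale :: "complex \<Rightarrow> 'v::ab_group_add \<Rightarrow> 'v" and \<rho>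
  assumes rep: "orth_rep n scale \<rho>"
begin

interpretation vector_space scale using rep by (simp add: orth_rep_def)

lemma rep_linear: "x \<in> orth n \<Longrightarrow> Vector_Spaces.linear scale scale (\<rho> x)"
  using rep by (simp add: orth_rep_def)

lemma word_linear:
  "w \<in> lists (orth n) \<Longrightarrow> Vector_Spaces.linear scale scale (foldr \<rho> w)"
proof (induction w)
  case Nil
  have "foldr \<rho> [] = (\<lambda>x. x)" by (simp add: fun_eq_iff)
  then show ?case using linear_ident by (simp only:)
next
  case (Cons x w)
  then show ?case
    using Vector_Spaces.linear_compose[of scale scale "foldr \<rho> w" scale "\<rho> x"] rep_linear[of x]
    by (auto simp: comp_def)
qed

lemma free_act_superset:
  assumes "finite S" "Poly_Mapping.keys p \<subseteq> S"
  shows "free_act scale \<rho> p v = (\<Sum>w\<in>S. scale (Poly_Mapping.lookup p w) (foldr \<rho> w v))"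
  unfolding free_act_def using assms
  by (intro sum.mono_neutral_left) (auto simp: in_keys_iff)

lemma free_act_add: "free_act scale \<rho> (p + q) v = free_act scale \<rho> p v + free_act scale \<rho> q v"
  using Poly_Mapping.keys_add[of p q]
  by (simp add: free_act_superset[of "Poly_Mapping.keys p \<union> Poly_Mapping.keys q"]
      lookup_add scale_left_distrib sum.distrib)

lemma free_act_uminus: "free_act scale \<rho> (- p) v = - free_act scale \<rho> p v"
  by (simp add: free_act_def sum_negf)

lemma free_act_diff: "free_act scale \<rho> (p - q) v = free_act scale \<rho> p v - free_act scale \<rho> q v"
  using free_act_add[of p "- q" v] by (simp add: free_act_uminus)

lemma free_act_zero: "free_act scale \<rho> 0 v = 0"
  by (simp add: free_act_def)

lemma free_act_single: "free_act scale \<rho> (Poly_Mapping.single w c) v = scale c (foldr \<rho> w v)"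
  by (simp add: free_act_def)

lemma free_act_sum: "free_act scale \<rho> (\<Sum>i\<in>S. f i) v = (\<Sum>i\<in>S. free_act scale \<rho> (f i) v)"
  by (induction S rule: infinite_finite_induct) (auto simp: free_act_zero free_act_add)

lemma free_act_mult:
  assumes "p \<in> carrier (free_alg n)"
  shows "free_act scale \<rho> (p * q) v = free_act scale \<rho> p (free_act scale \<rho> q v)"
proof -
  let ?l = "Poly_Mapping.lookup"
  have "p * q = (\<Sum>u\<in>Poly_Mapping.keys p. \<Sum>w\<in>Poly_Mapping.keys q.
      Poly_Mapping.single (u @ w) (?l p u * ?l q w))"
    by (rule trans[OF arg_cong2[OF free_decomp[of p] free_decomp[of q], of "(*)"]])
      (simp only: sum_product mult_single plus_list_def)
  then have "free_act scale \<rho> (p * q) v = (\<Sum>u\<in>Poly_Mapping.keys p. \<Sum>w\<in>Poly_Mapping.keys q.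
      scale (?l p u * ?l q w) (foldr \<rho> u (foldr \<rho> w v)))"
    by (simp add: free_act_sum free_act_single)
  also have "\<dots> = (\<Sum>u\<in>Poly_Mapping.keys p. scale (?l p u) (foldr \<rho> u (free_act scale \<rho> q v)))"
  proof (rule sum.cong)
    fix u assume "u \<in> Poly_Mapping.keys p"
    then have "u \<in> lists (orth n)" using assms by (auto simp: free_alg_def)
    then interpret u: Vector_Spaces.linear scale scale "foldr \<rho> u" by (rule word_linear)
    show "(\<Sum>w\<in>Poly_Mapping.keys q. scale (?l p u * ?l q w) (foldr \<rho> u (foldr \<rho> w v))) =
        scale (?l p u) (foldr \<rho> u (free_act scale \<rho> q v))"
      by (simp add: free_act_def u.sum u.scale scale_sum_right)
  qed simp
  finally show ?thesis by (simp add: free_act_def)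
qed

lemma free_act_zero_right:
  assumes "p \<in> carrier (free_alg n)"
  shows "free_act scale \<rho> p 0 = 0"
  using free_act_mult[OF assms, of 0 undefined] by (simp add: free_act_zero)

lemma free_act_relations:
  assumes "p \<in> uea_relations n"
  shows "free_act scale \<rho> p v = 0"
  using assms rep unfolding uea_relations_def
  by (auto simp: gen_def const_def free_act_diff free_act_add free_act_single mult_single
      plus_list_def orth_rep_def)

lemma free_act_ideal:
  assumes "p \<in> uea_ideal n"
  shows "free_act scale \<rho> p v = 0"
proof -
  let ?K = "{p \<in> carrier (free_alg n). \<forall>v. free_act scale \<rho> p v = 0}"
  have "ideal ?K (free_alg n)"
  proof (rule idealI[OF ring_free_alg])
    interpret R: ring "free_alg n" by (rule ring_free_alg)
    show "subgroup ?K (add_monoid (free_alg n))"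
    proof (rule R.add.subgroupI)
      have "0 \<in> ?K" by (simp add: free_alg_def free_act_zero)
      then show "?K \<noteq> {}" by blast
    next
      fix p assume p: "p \<in> ?K"
      have "\<ominus>\<^bsub>free_alg n\<^esub> p = - p"
        using p by (intro R.minus_equality) (auto simp: free_alg_def)
      then show "\<ominus>\<^bsub>free_alg n\<^esub> p \<in> ?K" using p by (auto simp: free_alg_def free_act_uminus)
    next
      fix p q assume "p \<in> ?K" "q \<in> ?K"
      then show "p \<oplus>\<^bsub>free_alg n\<^esub> q \<in> ?K"
        using free_closed(1)[of p n q] by (auto simp: free_act_add free_alg_def[of n])
    qed auto
  next
    fix p q assume "p \<in> ?K" "q \<in> carrier (free_alg n)"
    moreover have "mult (free_alg n) = (*)" by (simp add: free_alg_def)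
    ultimately show "q \<otimes>\<^bsub>free_alg n\<^esub> p \<in> ?K" "p \<otimes>\<^bsub>free_alg n\<^esub> q \<in> ?K"
      using free_closed(3)[of p n q] free_closed(3)[of q n p]
      by (simp_all add: free_act_mult free_act_zero_right)
  qed
  then have "uea_ideal n \<subseteq> ?K"
    unfolding uea_ideal_def
    using uea_relations_closed free_act_relations
    by (intro ring.genideal_minimal[OF ring_free_alg]) auto
  then show ?thesis using assms by auto
qed

lemma uea_act_class:
  assumes "p \<in> carrier (free_alg n)"
  shows "uea_act scale \<rho> (uea_class n p) = free_act scale \<rho> p"
proof -
  have "free_act scale \<rho> ` uea_class n p = {free_act scale \<rho> p}"
  proof -
    have "free_act scale \<rho> q = free_act scale \<rho> p" if q: "q \<in> uea_class n p" for q
    proof -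
      obtain r where "r \<in> uea_ideal n" "q = r + p"
        using q by (auto simp: uea_class_def a_r_coset_def r_coset_def free_alg_def)
      then show ?thesis by (auto simp: fun_eq_iff free_act_add free_act_ideal)
    qed
    moreover have "p \<in> uea_class n p"
      unfolding uea_class_def
      by (rule abelian_subgroup.a_rcos_self[OF ideal_abelian_subgroup assms])
    ultimately show ?thesis by blast
  qed
  then show ?thesis by (simp add: uea_act_def)
qed

end

end

theory Submission
  imports Defs "HOL-Library.Function_Algebras"
begin

text \<open>
  The adjoint action of a matrix \<open>g\<close> of the orthogonal Lie algebra on the elements \<open>X\<^sub>i\<^sub>,\<^sub>-\<^sub>j\<close> is that on
  exterior products of two vectors.  Hence the commutator of \<open>g\<close> with the alternating sum that defines the
  Pfaffian lets \<open>g\<close> act on all \<open>2 n\<close> indices, which multiplies the sum by the trace of \<open>g\<close>, and this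
  is zero (\<open>pf_sum_variation\<close>).  So the Pfaffian is central (\<open>Pf_X_central\<close>), and each of its eigenspaces
  in a representation is invariant.  In an irreducible representation it is therefore enough to compute the
  Pfaffian on a highest weight vector.

  For this computation, let \<open>e\<^sub>1, \<dots>, e\<^sub>2\<^sub>n\<close> be anticommuting variables that commute with the Lie algebra,
  and put \<open>\<Omega> = \<Sum> e\<^sub>i e\<^sub>j X\<^sub>i\<^sub>,\<^sub>-\<^sub>j\<close>.  Then \<open>\<Omega>\<^sup>n = 2\<^sup>n n! e\<^sub>1 \<cdots> e\<^sub>2\<^sub>n Pf\<close> (\<open>Omega_power_permutes\<close>).
  Separating the indices \<open>1\<close> and \<open>-1\<close> gives
  \<open>\<Omega> = \<Omega>' + 2 e\<^sub>1 a + 2 e\<^sub>-\<^sub>1 b + 2 e\<^sub>1 e\<^sub>-\<^sub>1 X\<^sub>1\<^sub>,\<^sub>1\<close>, where \<open>\<Omega>'\<close> belongs to the remaining indices, \<open>a\<close> is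
  built from raising and \<open>b\<close> from lowering operators.  All summands commute with \<open>\<Omega>'\<close>
  (\<open>contraction_Omega_commute\<close>, \<open>Omega_A_commute\<close>), and \<open>a b + b a = - \<Omega>'\<close> (\<open>contraction_anticommutator\<close>).  As \<open>a\<close>
  annihilates the highest weight vector \<open>v\<close>, the binomial theorem yields
  \<open>\<Omega>\<^sup>n v = 2 n (\<lambda>\<^sub>1 + n - 1) e\<^sub>1 e\<^sub>-\<^sub>1 \<Omega>'\<^sup>n\<^sup>-\<^sup>1 v\<close> (\<open>Omega_step\<close>), and induction on the rank
  gives the product.

  The computation is done in an abstract ring containing all these elements; a concrete one consists of
  endomorphisms of the functions from sets of indices to the representation space.
\<close>

section \<open>Products of anticommuting elements\<close>

text \<open>
  Elements \<open>e i\<close> that anticommute and square to zero, like the generators of an exterior algebra.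
  They live in an arbitrary ring with one, in which \<open>1 = 0\<close> is allowed.
\<close>

locale grassmann =
  fixes e :: "nat \<Rightarrow> 'a::{ring,monoid_mult}"
  assumes anticommute: "e i * e j = - (e j * e i)"
    and square: "e i * e i = 0"
begin

text \<open>
  The product \<open>e x\<^sub>1 \<cdots> e x\<^sub>k\<close> along a list of indices.
\<close>

definition eprod :: "nat list \<Rightarrow> 'a" where
  "eprod xs = prod_list (map e xs)"

lemma eprod_simps [simp]: "eprod [] = 1" "eprod (x # xs) = e x * eprod xs" "eprod (xs @ ys) = eprod xs * eprod ys"
  by (simp_all add: eprod_def)

lemma eprod_move:
  "e j * eprod xs = (if even (length xs) then eprod xs * e j else - (eprod xs * e j))"
proof (induction xs)
  case (Cons x xs)
  have "e j * eprod (x # xs) = - (e x * (e j * eprod xs))"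
    by (simp add: mult.assoc[symmetric] anticommute[of j x])
  then show ?case
    unfolding Cons.IH by (simp add: mult.assoc)
qed simp

lemma eprod_swap: "eprod (xs @ a # ys @ b # zs) = - eprod (xs @ b # ys @ a # zs)"
proof -
  have "e a * eprod ys * e b = - (e b * eprod ys * e a)"
    unfolding eprod_move by (simp add: mult.assoc anticommute[of a b])
  then have "eprod xs * (e a * eprod ys * e b) * eprod zs = eprod xs * (- (e b * eprod ys * e a)) * eprod zs"
    by simp
  then show ?thesis by (simp add: mult.assoc)
qed

lemma eprod_not_distinct:
  assumes "\<not> distinct xs"
  shows "eprod xs = 0"
proof -
  obtain us y vs ws where xs: "xs = us @ [y] @ vs @ [y] @ ws"
    using not_distinct_decomp[OF assms] by blast
  have "e y * eprod vs * e y = 0"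
    unfolding eprod_move by (simp add: mult.assoc square)
  then have "eprod us * (e y * eprod vs * e y) * eprod ws = 0"
    by simp
  then show ?thesis by (simp add: xs mult.assoc)
qed

lemma eprod_transpose:
  assumes "distinct xs" "a \<in> set xs" "b \<in> set xs" "a \<noteq> b"
  shows "eprod (map (Transposition.transpose a b) xs) = - eprod xs"
proof -
  have *: "eprod (map (Transposition.transpose x y) xs) = - eprod xs"
    if xs: "xs = us @ x # vs @ y # ws" for x y us vs ws
  proof -
    have "map (Transposition.transpose x y) us = us" "map (Transposition.transpose x y) vs = vs"
      "map (Transposition.transpose x y) ws = ws"
      using assms(1) unfolding xs by (auto intro!: map_idI simp: Transposition.transpose_def)
    then show ?thesis
      using eprod_swap[of us x vs y ws] unfolding xs by simp
  qed
  obtain us vs where us: "xs = us @ a # vs" using assms(2) by (meson split_list)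
  show ?thesis
  proof (cases "b \<in> set vs")
    case True
    then obtain ys zs where "vs = ys @ b # zs" by (meson split_list)
    then show ?thesis using us *[of us a ys b zs] by simp
  next
    case False
    then have "b \<in> set us" using assms us by auto
    then obtain ys zs where "us = ys @ b # zs" by (meson split_list)
    then show ?thesis using us *[of ys b zs a vs] by (simp add: transpose_commute)
  qed
qed

lemma eprod_permutes:
  assumes "\<sigma> permutes {1..N}"
  shows "eprod (map \<sigma> [1..<N + 1]) =
    (if evenperm \<sigma> then eprod [1..<N + 1] else - eprod [1..<N + 1])"
  using assms finite_atLeastAtMost
proof (induction rule: permutes_induct)
  case (swap a b p)
  have p: "permutation p" using swap by (auto simp: permutation_permutes)
  have set: "set (map p [1..<N + 1]) = {1..N}"
    using permutes_image[OF \<open>p permutes {1..N}\<close>]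
    by (simp only: set_map set_upt Suc_eq_plus1[symmetric] atLeastLessThanSuc_atLeastAtMost)
  have "distinct (map p [1..<N + 1])"
    using permutes_inj[OF \<open>p permutes {1..N}\<close>] by (auto simp: distinct_map inj_on_def)
  then have "eprod (map (Transposition.transpose a b) (map p [1..<N + 1])) = - eprod (map p [1..<N + 1])"
    by (rule eprod_transpose) (use set swap in auto)
  moreover have "evenperm (Transposition.transpose a b \<circ> p) = (\<not> evenperm p)"
    using swap p by (simp add: evenperm_comp permutation_swap_id evenperm_swap)
  ultimately show ?case
    unfolding map_map swap.IH by (simp only:) simp
qed (simp add: id_def)

end

section \<open>The quadratic element and its powers\<close>

lemma sum_PiE_insert:
  assumes "x \<notin> I"
  shows "(\<Sum>f\<in>insert x I \<rightarrow>\<^sub>E S. F f) = (\<Sum>g\<in>I \<rightarrow>\<^sub>E S. \<Sum>y\<in>S. F (g(x := y)))"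
proof -
  have "(\<Sum>f\<in>insert x I \<rightarrow>\<^sub>E S. F f) = (\<Sum>(y, g)\<in>S \<times> (I \<rightarrow>\<^sub>E S). F (g(x := y)))"
    unfolding PiE_insert_eq
    by (subst sum.reindex[OF inj_combinator[OF assms]]) (auto intro!: sum.cong)
  also have "\<dots> = (\<Sum>g\<in>I \<rightarrow>\<^sub>E S. \<Sum>y\<in>S. F (g(x := y)))"
    by (subst sum.swap) (rule sum.cartesian_product[symmetric])
  finally show ?thesis .
qed

lemma neg_neg: "i \<in> {1..2 * n} \<Longrightarrow> neg n (neg n i) = i"
  by (auto simp: neg_def)

lemma neg_in: "i \<in> {1..2 * n} \<Longrightarrow> neg n i \<in> {1..2 * n}"
  by (auto simp: neg_def)

text \<open>
  The tensor product of an exterior algebra with the enveloping algebra of the orthogonal Lie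
  algebra, or an image of this product in a ring of operators: \<open>A i j\<close> stands for \<open>X\<^sub>i\<^sub>,\<^sub>-\<^sub>j\<close>, which is alternating in
  \<open>i\<close> and \<open>j\<close>, and \<open>c\<close> embeds the complex scalars.  The commutation
  relations of the \<open>A i j\<close> are only required for indices in range.
\<close>

locale orth_grassmann = grassmann e
  for e :: "nat \<Rightarrow> 'a::{ring,monoid_mult}" +
  fixes n :: nat and A :: "nat \<Rightarrow> nat \<Rightarrow> 'a" and c :: "complex \<Rightarrow> 'a"
  assumes c_add: "c (x + y) = c x + c y"
    and c_mult: "c (x * y) = c x * c y"
    and c_one: "c 1 = 1"
    and c_e: "e i * c x = c x * e i"
    and c_A: "A i j * c x = c x * A i j"
    and A_e: "A k l * e i = e i * A k l"
    and A_alt: "A j i = - A i j"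
    and A_comm: "\<lbrakk>i \<in> {1..2 * n}; j \<in> {1..2 * n}; k \<in> {1..2 * n}; l \<in> {1..2 * n}\<rbrakk> \<Longrightarrow>
      A i j * A k l - A k l * A i j =
        (if k = neg n j then A i l else 0) - (if k = neg n i then A j l else 0) +
        (if l = neg n j then A k i else 0) - (if l = neg n i then A k j else 0)"
begin

lemma left_comm: "e i * (c x * z) = c x * (e i * z)" "A i j * (c x * z) = c x * (A i j * z)"
  "A k l * (e i * z) = e i * (A k l * z)"
  by (simp_all add: mult.assoc[symmetric] c_e c_A A_e)

lemmas left_normal = mult.assoc c_e c_A A_e left_comm

lemma c_zero: "c 0 = 0"
  using c_add[of 0 0] by simp

lemma c_uminus: "c (- x) = - c x"
  using c_add[of x "- x"] by (simp add: c_zero eq_neg_iff_add_eq_0 add.commute)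

lemma c_c: "c x * (c y * z) = c (x * y) * z"
  by (simp add: c_mult mult.assoc)

lemma c_two: "c 2 * z = z + z"
proof -
  have "c (1 + 1) * z = z + z" unfolding c_add by (simp add: c_one algebra_simps)
  then show ?thesis by simp
qed

lemma double_zero:
  assumes "x + x = (0::'a)"
  shows "x = 0"
proof -
  have "x = c (1/2) * (c 2 * x)" unfolding c_c by (simp add: c_one)
  then show ?thesis using assms by (simp add: c_two)
qed

text \<open>
  The element \<open>\<Sum> e\<^sub>i e\<^sub>j X\<^sub>i\<^sub>,\<^sub>-\<^sub>j\<close> over the indices in \<open>S\<close>.  For \<open>S = {1..2 * n}\<close> its \<open>n\<close>-th power is,
  up to the factor \<open>2\<^sup>n n!\<close>, the Pfaffian times \<open>e\<^sub>1 \<cdots> e\<^sub>2\<^sub>n\<close>.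
\<close>

definition Omega :: "nat set \<Rightarrow> 'a" where
  "Omega S = (\<Sum>i\<in>S. \<Sum>j\<in>S. e i * e j * A i j)"

text \<open>
  The cofactor of \<open>2 e p\<close> among the new terms \<open>e p e j A p j + e j e p A j p\<close> with \<open>j \<in> S\<close> when an index \<open>p\<close>
  is adjoined to \<open>S\<close>.
\<close>

definition contraction :: "nat set \<Rightarrow> nat \<Rightarrow> 'a" where
  "contraction S p = (\<Sum>j\<in>S. e j * A p j)"

text \<open>
  The bilinear form with matrix \<open>J\<close> is symmetric, so its contraction with anticommuting variables
  vanishes.  Commutator terms containing this contraction therefore drop out of
  \<open>contraction_Omega_commute\<close> and \<open>contraction_anticommutator\<close>.
\<close>

lemma sum_e_e_neg:
  assumes "S \<subseteq> {1..2 * n}" "neg n ` S \<subseteq> S"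
  shows "(\<Sum>j\<in>S. e j * e (neg n j)) = 0"
proof -
  have "(\<Sum>j\<in>S. e j * e (neg n j)) = (\<Sum>j\<in>S. e (neg n j) * e j)"
    using assms by (intro sum.reindex_bij_witness[of _ "neg n" "neg n"]) (auto simp: neg_neg subset_iff)
  also have "\<dots> = - (\<Sum>j\<in>S. e j * e (neg n j))"
    unfolding sum_negf[symmetric] by (rule sum.cong[OF refl], rule anticommute)
  finally show ?thesis using double_zero eq_neg_iff_add_eq_0 by blast
qed

lemma contraction_Omega_commute:
  assumes S: "S \<subseteq> {1..2 * n}" "neg n ` S \<subseteq> S" and p: "p \<in> {1..2 * n}" "p \<notin> S"
  shows "contraction S p * Omega S = Omega S * contraction S p"
proof -
  have fin: "finite S" using S(1) by (rule finite_subset) simp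
  have np: "k \<noteq> neg n p" if "k \<in> S" for k using S p that neg_neg[of p] by auto
  have "contraction S p * Omega S - Omega S * contraction S p =
    (\<Sum>j\<in>S. \<Sum>k\<in>S. \<Sum>l\<in>S. (e j * A p j) * (e k * e l * A k l)) -
    (\<Sum>j\<in>S. \<Sum>k\<in>S. \<Sum>l\<in>S. (e k * e l * A k l) * (e j * A p j))"
  proof (rule arg_cong2[where f = minus])
    show "contraction S p * Omega S = (\<Sum>j\<in>S. \<Sum>k\<in>S. \<Sum>l\<in>S. (e j * A p j) * (e k * e l * A k l))"
      unfolding contraction_def Omega_def sum_distrib_right unfolding sum_distrib_left ..
    show "Omega S * contraction S p = (\<Sum>j\<in>S. \<Sum>k\<in>S. \<Sum>l\<in>S. (e k * e l * A k l) * (e j * A p j))"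
      unfolding contraction_def Omega_def sum_distrib_left[of _ "\<lambda>j. e j * A p j"]
      unfolding sum_distrib_right ..
  qed
  also have "\<dots> = (\<Sum>j\<in>S. \<Sum>k\<in>S. \<Sum>l\<in>S. e j * e k * e l * (A p j * A k l - A k l * A p j))"
  proof -
    have "(e j * A p j) * (e k * e l * A k l) - (e k * e l * A k l) * (e j * A p j) =
        e j * e k * e l * (A p j * A k l - A k l * A p j)" for j k l
    proof -
      have "e k * (e l * (e j * z)) = e j * (e k * (e l * z))" for z
        using eprod_move[of j "[k, l]"] by (simp add: mult.assoc[symmetric])
      then show ?thesis by (simp add: left_normal right_diff_distrib)
    qed
    then show ?thesis by (simp add: sum_subtractf[symmetric])
  qed
  also have "\<dots> = (\<Sum>j\<in>S. \<Sum>k\<in>S. \<Sum>l\<in>S.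
      (if k = neg n j then e j * e k * e l * A p l else 0) +
      (if l = neg n j then e j * e k * e l * A k p else 0))"
    using S(1) p np by (intro sum.cong refl) (auto simp: A_comm subset_iff algebra_simps)
  also have "\<dots> = (\<Sum>j\<in>S. \<Sum>k\<in>S. \<Sum>l\<in>S. if k = neg n j then e j * e k * e l * A p l else 0) +
      (\<Sum>j\<in>S. \<Sum>k\<in>S. \<Sum>l\<in>S. if l = neg n j then e j * e k * e l * A k p else 0)"
    by (simp add: sum.distrib)
  also have "(\<Sum>j\<in>S. \<Sum>k\<in>S. \<Sum>l\<in>S. if k = neg n j then e j * e k * e l * A p l else 0) =
      (\<Sum>j\<in>S. \<Sum>l\<in>S. e j * e (neg n j) * e l * A p l)"
  proof (rule sum.cong[OF refl])
    fix j assume "j \<in> S"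
    then have "neg n j \<in> S" using S by auto
    then show "(\<Sum>k\<in>S. \<Sum>l\<in>S. if k = neg n j then e j * e k * e l * A p l else 0) =
        (\<Sum>l\<in>S. e j * e (neg n j) * e l * A p l)"
      using fin by (subst sum.swap) simp
  qed
  also have "\<dots> = (\<Sum>j\<in>S. e j * e (neg n j)) * (\<Sum>l\<in>S. e l * A p l)"
    by (simp add: sum_product mult.assoc)
  also have "\<dots> = 0" using sum_e_e_neg[OF S] by simp
  also have "(\<Sum>j\<in>S. \<Sum>k\<in>S. \<Sum>l\<in>S. if l = neg n j then e j * e k * e l * A k p else 0) =
      (\<Sum>j\<in>S. \<Sum>k\<in>S. e j * e k * e (neg n j) * A k p)"
  proof (intro sum.cong[OF refl])
    fix j k assume "j \<in> S"
    then have "neg n j \<in> S" using S by auto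
    then show "(\<Sum>l\<in>S. if l = neg n j then e j * e k * e l * A k p else 0) =
        e j * e k * e (neg n j) * A k p"
      using fin by simp
  qed
  also have "\<dots> = (\<Sum>j\<in>S. \<Sum>k\<in>S. e j * e (neg n j) * - (e k * A k p))"
  proof (intro sum.cong[OF refl])
    fix j k
    have "e k * e (neg n j) * A k p = - (e (neg n j) * e k * A k p)" by (simp add: anticommute[of k "neg n j"])
    then have "e j * (e k * e (neg n j) * A k p) = e j * (- (e (neg n j) * e k * A k p))" by simp
    then show "e j * e k * e (neg n j) * A k p = e j * e (neg n j) * - (e k * A k p)"
      by (simp add: mult.assoc)
  qed
  also have "\<dots> = (\<Sum>j\<in>S. e j * e (neg n j)) * (\<Sum>k\<in>S. - (e k * A k p))"
    by (simp only: sum_product)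
  also have "\<dots> = 0" using sum_e_e_neg[OF S] by simp
  finally show ?thesis by simp
qed

lemma Omega_A_commute:
  assumes S: "S \<subseteq> {1..2 * n}" and p: "p \<in> {1..2 * n}" "p \<notin> S" "neg n p \<notin> S"
  shows "A p (neg n p) * Omega S = Omega S * A p (neg n p)"
proof -
  have "A p (neg n p) * A k l = A k l * A p (neg n p)" if kl: "k \<in> S" "l \<in> S" for k l
  proof -
    have "k \<noteq> p" "k \<noteq> neg n p" "l \<noteq> p" "l \<noteq> neg n p" using kl p(2,3) by auto
    then show ?thesis
      using A_comm[OF p(1) neg_in[OF p(1)], of k l] neg_neg[OF p(1)] kl S by (simp add: subset_iff)
  qed
  then have "A p (neg n p) * (e k * e l * A k l) = e k * e l * A k l * A p (neg n p)"
    if "k \<in> S" "l \<in> S" for k l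
    using that by (simp add: left_normal)
  then show ?thesis by (simp add: Omega_def sum_distrib_left sum_distrib_right)
qed

text \<open>
  The only commutator that survives when the rows \<open>p\<close> and \<open>-p\<close> are split off from \<open>Omega\<close>; it gives
  back \<open>Omega\<close> for the remaining indices and is the source of the shifts \<open>n - i\<close>.
\<close>

lemma contraction_anticommutator:
  assumes S: "S \<subseteq> {1..2 * n}" "neg n ` S \<subseteq> S" and p: "p \<in> {1..2 * n}" "p \<notin> S"
  shows "contraction S p * contraction S (neg n p) + contraction S (neg n p) * contraction S p = - Omega S"
proof -
  let ?q = "neg n p"
  have fin: "finite S" using S(1) by (rule finite_subset) simp
  have np: "k \<noteq> ?q" if "k \<in> S" for k using S p that neg_neg[of p] by auto
  have nq: "neg n k \<noteq> ?q" if "k \<in> S" for k using S p that np by blast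
  have q: "?q \<in> {1..2 * n}" by (rule neg_in[OF p(1)])
  have "contraction S p * contraction S ?q + contraction S ?q * contraction S p =
      (\<Sum>j\<in>S. \<Sum>k\<in>S. (e j * A p j) * (e k * A ?q k)) + (\<Sum>j\<in>S. \<Sum>k\<in>S. (e k * A ?q k) * (e j * A p j))"
    unfolding contraction_def
    by (subst (2) sum.swap) (simp add: sum_product)
  also have "\<dots> = (\<Sum>j\<in>S. \<Sum>k\<in>S. e j * e k * (A p j * A ?q k - A ?q k * A p j))"
  proof -
    have "(e j * A p j) * (e k * A ?q k) + (e k * A ?q k) * (e j * A p j) =
        e j * e k * (A p j * A ?q k - A ?q k * A p j)" for j k
    proof -
      have "e k * (e j * z) = - (e j * (e k * z))" for z
        by (simp add: mult.assoc[symmetric] anticommute[of k j])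
      then show ?thesis by (simp add: left_normal right_diff_distrib)
    qed
    then show ?thesis by (simp add: sum.distrib[symmetric])
  qed
  also have "\<dots> = (\<Sum>j\<in>S. \<Sum>k\<in>S. - (e j * e k * A j k) + (if k = neg n j then e j * e k * A ?q p else 0))"
  proof (intro sum.cong refl)
    fix j k assume jk: "j \<in> S" "k \<in> S"
    have "A p j * A ?q k - A ?q k * A p j = - A j k + (if k = neg n j then A ?q p else 0)"
      using A_comm[OF p(1) _ q, of j k] np nq[of j] jk S(1) by (auto simp: subset_iff)
    then show "e j * e k * (A p j * A ?q k - A ?q k * A p j) =
        - (e j * e k * A j k) + (if k = neg n j then e j * e k * A ?q p else 0)"
      by (simp only: distrib_left) simp
  qed
  also have "\<dots> = - Omega S + (\<Sum>j\<in>S. e j * e (neg n j)) * A ?q p"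
  proof -
    have "(\<Sum>k\<in>S. if k = neg n j then e j * e k * A ?q p else 0) = e j * e (neg n j) * A ?q p"
      if "j \<in> S" for j
    proof -
      have "neg n j \<in> S" using S that by auto
      then show ?thesis using fin by simp
    qed
    then show ?thesis
      by (simp add: sum.distrib Omega_def sum_negf sum_subtractf sum_distrib_right)
  qed
  also have "\<dots> = - Omega S" by (simp add: sum_e_e_neg[OF S])
  finally show ?thesis .
qed

lemma contraction_e: "contraction S p * e i = - (e i * contraction S p)"
proof -
  have "contraction S p * e i = (\<Sum>j\<in>S. - (e i * (e j * A p j)))"
    unfolding contraction_def sum_distrib_right
  proof (rule sum.cong[OF refl])
    fix j
    have "e j * (e i * A p j) = - (e i * (e j * A p j))"
      by (simp add: mult.assoc[symmetric] anticommute[of j i])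
    then show "e j * A p j * e i = - (e i * (e j * A p j))" by (simp add: left_normal)
  qed
  then show ?thesis by (simp add: contraction_def sum_negf sum_distrib_left)
qed

lemma Omega_insert:
  assumes "finite S" "p \<notin> S" "q \<notin> S" "p \<noteq> q"
  shows "Omega (insert p (insert q S)) = Omega S +
    (c 2 * (e p * contraction S p) + c 2 * (e q * contraction S q) + c 2 * (e p * e q * A p q))"
proof -
  have flip: "e j * (e i * A j i) = e i * (e j * A i j)" for i j
    by (simp add: mult.assoc[symmetric] anticommute[of j i] A_alt[of j i])
  have flip_sum: "(\<Sum>j\<in>S. e j * (e i * A j i)) = (\<Sum>j\<in>S. e i * (e j * A i j))" for i
    by (rule sum.cong[OF refl flip])
  have diag: "e i * (e i * z) = 0" for i z by (simp add: square mult.assoc[symmetric])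
  have "Omega (insert p (insert q S)) =
      (\<Sum>j\<in>S. e p * e j * A p j) + (\<Sum>j\<in>S. e q * e j * A q j) +
      ((\<Sum>i\<in>S. e i * e p * A i p) + (\<Sum>i\<in>S. e i * e q * A i q)) + Omega S +
      (e p * e q * A p q + e q * e p * A q p)"
    using assms by (simp add: Omega_def sum.distrib algebra_simps) (simp add: diag)
  then show ?thesis
    by (simp add: flip_sum[of p] flip_sum[of q] flip[of q p] c_two contraction_def sum_distrib_left mult.assoc
        sum.distrib add_ac)
qed

text \<open>
  The summand \<open>A i\<^sub>1 i\<^sub>2 \<cdots> A i\<^sub>2\<^sub>m\<^sub>-\<^sub>1 i\<^sub>2\<^sub>m\<close> attached to an index sequence \<open>i\<close> with domain \<open>{1..2 * m}\<close>.
\<close>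

definition word :: "nat \<Rightarrow> (nat \<Rightarrow> nat) \<Rightarrow> 'a" where
  "word m i = prod_list (map (\<lambda>k. A (i (2 * k - 1)) (i (2 * k))) [1..<m + 1])"

lemma word_cong: "(\<And>k. k \<in> {1..2 * m} \<Longrightarrow> i k = i' k) \<Longrightarrow> word m i = word m i'"
  unfolding word_def
proof (intro arg_cong[of _ _ prod_list] map_cong refl)
  fix k assume *: "\<And>k. k \<in> {1..2 * m} \<Longrightarrow> i k = i' k" and "k \<in> set [1..<m + 1]"
  then have "2 * k - 1 \<in> {1..2 * m}" "2 * k \<in> {1..2 * m}" by auto
  then show "A (i (2 * k - 1)) (i (2 * k)) = A (i' (2 * k - 1)) (i' (2 * k))"
    by (simp only: *)
qed

lemma prod_A_e: "prod_list (map (\<lambda>k. A (f k) (g k)) ks) * e j = e j * prod_list (map (\<lambda>k. A (f k) (g k)) ks)"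
  by (induction ks) (simp_all add: mult.assoc A_e, simp add: left_normal)

lemma word_e: "word m i * e j = e j * word m i"
  unfolding word_def by (rule prod_A_e)

lemma word_eprod: "word m i * eprod xs = eprod xs * word m i"
proof (induction xs)
  case (Cons x xs)
  have "word m i * eprod (x # xs) = e x * (word m i * eprod xs)"
    by (simp add: mult.assoc[symmetric] word_e)
  then show ?case by (simp add: Cons.IH mult.assoc)
qed simp

lemma Omega_power:
  "Omega S ^ m = (\<Sum>i\<in>{1..2 * m} \<rightarrow>\<^sub>E S. eprod (map i [1..<2 * m + 1]) * word m i)"
proof (induction m)
  case 0
  then show ?case by (simp add: word_def)
next
  case (Suc m)
  let ?N = "2 * m"
  have "Omega S ^ Suc m = (\<Sum>i\<in>{1..?N} \<rightarrow>\<^sub>E S. eprod (map i [1..<?N + 1]) * word m i) *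
      (\<Sum>x\<in>S. \<Sum>y\<in>S. e x * e y * A x y)"
    unfolding power_Suc2 Suc.IH by (simp only: Omega_def)
  also have "\<dots> = (\<Sum>i\<in>{1..?N} \<rightarrow>\<^sub>E S. \<Sum>x\<in>S. \<Sum>y\<in>S.
      eprod (map i [1..<?N + 1]) * word m i * (e x * e y * A x y))"
    by (simp only: sum_distrib_right, simp only: sum_distrib_left)
  also have "\<dots> = (\<Sum>i\<in>{1..?N} \<rightarrow>\<^sub>E S. \<Sum>x\<in>S. \<Sum>y\<in>S.
      eprod (map (i(?N + 1 := x, ?N + 2 := y)) [1..<2 * Suc m + 1]) *
      word (Suc m) (i(?N + 1 := x, ?N + 2 := y)))"
  proof (intro sum.cong refl)
    fix i :: "nat \<Rightarrow> nat" and x y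
    let ?i = "i(?N + 1 := x, ?N + 2 := y)"
    have "[1..<2 * Suc m + 1] = [1..<?N + 1] @ [?N + 1, ?N + 2]" by simp
    then have "eprod (map ?i [1..<2 * Suc m + 1]) = eprod (map ?i [1..<?N + 1]) * (e x * e y)"
      by simp
    also have "map ?i [1..<?N + 1] = map i [1..<?N + 1]" by (rule map_cong) auto
    finally have 1: "eprod (map ?i [1..<2 * Suc m + 1]) = eprod (map i [1..<?N + 1]) * (e x * e y)" .
    have "word (Suc m) ?i = word m ?i * A x y"
      by (simp add: word_def)
    also have "word m ?i = word m i" by (rule word_cong) auto
    finally have 2: "word (Suc m) ?i = word m i * A x y" .
    have "word m i * (e x * e y) = e x * e y * word m i"
      using word_eprod[of m i "[x, y]"] by simp
    from arg_cong[OF this, of "\<lambda>z. eprod (map i [1..<?N + 1]) * z * A x y"]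
    show "eprod (map i [1..<?N + 1]) * word m i * (e x * e y * A x y) =
        eprod (map ?i [1..<2 * Suc m + 1]) * word (Suc m) ?i"
      unfolding 1 2 by (simp only: mult.assoc)
  qed
  also have "\<dots> = (\<Sum>i\<in>insert (?N + 2) (insert (?N + 1) {1..?N}) \<rightarrow>\<^sub>E S.
      eprod (map i [1..<2 * Suc m + 1]) * word (Suc m) i)"
    by (simp add: sum_PiE_insert)
  also have "insert (?N + 2) (insert (?N + 1) {1..?N}) = {1..2 * Suc m}" by auto
  finally show ?case .
qed

text \<open>
  More than \<open>card S\<close> factors \<open>e j\<close> with \<open>j \<in> S\<close> contain a repetition.
\<close>

lemma Omega_power_eprod_zero:
  assumes "finite S" "set xs \<subseteq> S" "2 * m + length xs > card S"
  shows "Omega S ^ m * eprod xs = 0"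
proof -
  have "eprod (map i [1..<2 * m + 1]) * word m i * eprod xs = 0" if i: "i \<in> {1..2 * m} \<rightarrow>\<^sub>E S" for i
  proof -
    let ?ys = "map i [1..<2 * m + 1] @ xs"
    have "set ?ys \<subseteq> S" using i assms(2) by auto
    then have "card (set ?ys) \<le> card S" by (rule card_mono[OF assms(1)])
    moreover have "length ?ys = 2 * m + length xs" by simp
    ultimately have "\<not> distinct ?ys" using distinct_card[of ?ys] assms(3) by linarith
    then have "eprod ?ys = 0" by (rule eprod_not_distinct)
    then have "eprod (map i [1..<2 * m + 1]) * eprod xs * word m i = 0" by simp
    then show ?thesis by (simp only: mult.assoc word_eprod)
  qed
  then show ?thesis by (simp add: Omega_power sum_distrib_right)
qed

lemma c_commute_power: "(\<And>x. y * c x = c x * y) \<Longrightarrow> y ^ m * c x = c x * y ^ m"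
  by (induction m) (simp_all add: mult.assoc, simp add: mult.assoc[symmetric])

lemma Omega_c: "Omega S * c x = c x * Omega S"
  by (simp add: Omega_def sum_distrib_left sum_distrib_right left_normal)

lemma Omega_power_c: "Omega S ^ m * c x = c x * Omega S ^ m"
  by (intro c_commute_power Omega_c)

lemma Omega_e: "Omega S * e i = e i * Omega S"
proof -
  have "e x * e y * A x y * e i = e i * (e x * e y * A x y)" for x y
    using eprod_move[of i "[x, y]"] by (simp add: left_normal) (simp add: mult.assoc[symmetric])
  then show ?thesis by (simp add: Omega_def sum_distrib_left sum_distrib_right)
qed

lemma Omega_power_e: "Omega S ^ m * e i = e i * Omega S ^ m"
  by (rule power_commuting_commutes) (rule Omega_e)

text \<open>
  The binomial theorem for commuting \<open>M\<close> and \<open>N\<close> with \<open>N\<^sup>3 = 0\<close>.  Where the truncated exponents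
  \<open>m - 1\<close> and \<open>m - 2\<close> are off, the binomial coefficient is zero.
\<close>

lemma binomial_nilpotent:
  assumes "M * N = N * M" "N * N * N = 0" and M: "\<And>x. M * c x = c x * M" and N: "\<And>x. N * c x = c x * N"
  shows "(M + N) ^ m = M ^ m + c (of_nat m) * (M ^ (m - 1) * N) +
    c (of_nat (m choose 2)) * (M ^ (m - 2) * (N * N))"
proof (induction m)
  case 0
  then show ?case by (simp add: c_zero binomial_eq_0)
next
  case (Suc m)
  have lc: "M * (c x * z) = c x * (M * z)" "N * (c x * z) = c x * (N * z)" for x z
    by (simp_all add: mult.assoc[symmetric] M N)
  have NM: "N * M ^ k = M ^ k * N" for k
    using power_commuting_commutes[of M N k] assms(1) by simp
  have a: "c (of_nat m) * (M * (M ^ (m - Suc 0) * z)) = c (of_nat m) * (M ^ m * z)" for z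
    by (cases m) (simp_all add: mult.assoc c_zero)
  have b: "c (of_nat (m choose 2)) * (M * (M ^ (m - 2) * z)) = c (of_nat (m choose 2)) * (M ^ (m - Suc 0) * z)" for z
  proof (cases "m \<ge> 2")
    case True
    then obtain k where "m = Suc (Suc k)" by (metis Suc_le_D numeral_2_eq_2 Suc_le_mono)
    then show ?thesis by (simp add: mult.assoc)
  qed (simp add: binomial_eq_0 c_zero)
  have N3: "M ^ k * (N * (N * N)) = 0" for k using assms(2) by (simp add: mult.assoc)
  have NM': "N * (M ^ k * z) = M ^ k * (N * z)" for k z
    by (simp add: mult.assoc[symmetric] NM)
  have "(M + N) ^ Suc m = (M + N) * (M ^ m + c (of_nat m) * (M ^ (m - 1) * N) +
    c (of_nat (m choose 2)) * (M ^ (m - 2) * (N * N)))"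
    by (simp only: power_Suc Suc.IH)
  also have "\<dots> = M ^ Suc m + (c (of_nat m) * (M ^ m * N) + M ^ m * N) +
      (c (of_nat (m choose 2)) * (M ^ (m - 1) * (N * N)) + c (of_nat m) * (M ^ (m - 1) * (N * N)))"
    by (simp add: distrib_left distrib_right lc a b NM NM' N3 add.assoc)
  also have "\<dots> = M ^ Suc m + c (of_nat (Suc m)) * (M ^ m * N) +
      c (of_nat (Suc m choose 2)) * (M ^ (m - 1) * (N * N))"
    by (simp add: c_add c_one distrib_right numeral_2_eq_2 add_ac)
  finally show ?case by simp
qed

lemma contraction_c: "contraction S p * c x = c x * contraction S p"
  by (simp add: contraction_def sum_distrib_left sum_distrib_right left_normal)

text \<open>
  Among the index sequences in the expansion of the top power, only the permutations contribute.
\<close>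

lemma Omega_power_permutes:
  "Omega {1..2 * n} ^ n = (\<Sum>\<sigma> | \<sigma> permutes {1..2 * n}.
     c (of_int (sign \<sigma>)) * (eprod [1..<2 * n + 1] * word n \<sigma>))"
proof -
  let ?I = "{1..2 * n}"
  let ?F = "\<lambda>i. eprod (map i [1..<2 * n + 1]) * word n i"
  let ?P = "{\<sigma>. \<sigma> permutes ?I}"
  let ?r = "\<lambda>\<sigma>. restrict \<sigma> ?I"
  have inj: "inj_on ?r ?P"
  proof (rule inj_onI)
    fix \<sigma> \<tau> assume "\<sigma> \<in> ?P" "\<tau> \<in> ?P" and eq: "?r \<sigma> = ?r \<tau>"
    then have P: "\<sigma> permutes ?I" "\<tau> permutes ?I" by simp_all
    show "\<sigma> = \<tau>"
    proof
      fix x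
      show "\<sigma> x = \<tau> x"
        using fun_cong[OF eq, of x] permutes_not_in[OF P(1)] permutes_not_in[OF P(2)]
        by (cases "x \<in> ?I") (simp_all del: atLeastAtMost_iff)
    qed
  qed
  have sub: "?r ` ?P \<subseteq> ?I \<rightarrow>\<^sub>E ?I"
    using permutes_in_image by (fastforce simp: PiE_iff)
  have zero: "?F i = 0" if i: "i \<in> (?I \<rightarrow>\<^sub>E ?I) - ?r ` ?P" for i
  proof -
    have "\<not> inj_on i ?I"
    proof
      assume inj: "inj_on i ?I"
      define \<sigma> where "\<sigma> x = (if x \<in> ?I then i x else x)" for x
      have "i ` ?I = ?I" using i inj by (intro endo_inj_surj) auto
      then have "bij_betw i ?I ?I" using inj by (simp add: bij_betw_def)
      then have "bij_betw \<sigma> ?I ?I" by (rule bij_betw_cong[THEN iffD1, rotated]) (simp add: \<sigma>_def)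
      then have "\<sigma> permutes ?I" by (rule bij_imp_permutes) (auto simp: \<sigma>_def)
      moreover have "i = ?r \<sigma>" using i by (auto simp: \<sigma>_def PiE_iff extensional_def fun_eq_iff)
      ultimately show False using i by blast
    qed
    then have "\<not> distinct (map i [1..<2 * n + 1])"
      by (simp only: distinct_map set_upt Suc_eq_plus1[symmetric] atLeastLessThanSuc_atLeastAtMost) simp
    then show ?thesis by (simp only: eprod_not_distinct[of "map i [1..<2 * n + 1]"] mult_zero_left not_False_eq_True)
  qed
  have "Omega ?I ^ n = (\<Sum>i\<in>?I \<rightarrow>\<^sub>E ?I. ?F i)" by (rule Omega_power)
  also have "\<dots> = (\<Sum>i\<in>?r ` ?P. ?F i)"
    using sub zero by (intro sum.mono_neutral_right finite_PiE) auto
  also have "\<dots> = (\<Sum>\<sigma>\<in>?P. ?F (?r \<sigma>))" using inj by (simp add: sum.reindex)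
  also have "\<dots> = (\<Sum>\<sigma>\<in>?P. c (of_int (sign \<sigma>)) * (eprod [1..<2 * n + 1] * word n \<sigma>))"
  proof (rule sum.cong[OF refl])
    fix \<sigma> assume "\<sigma> \<in> ?P"
    then have \<sigma>: "\<sigma> permutes ?I" by simp
    have 1: "map (?r \<sigma>) [1..<2 * n + 1] = map \<sigma> [1..<2 * n + 1]" by (rule map_cong) auto
    have 2: "word n (?r \<sigma>) = word n \<sigma>" by (rule word_cong) auto
    show "?F (?r \<sigma>) = c (of_int (sign \<sigma>)) * (eprod [1..<2 * n + 1] * word n \<sigma>)"
      unfolding 1 2 eprod_permutes[OF \<sigma>] by (simp add: sign_def c_one c_uminus)
  qed
  finally show ?thesis .
qed

end

text \<open>
  \<open>ev x\<close> is the result of applying \<open>x\<close> to a highest weight vector whose weight takes the value \<open>l i\<close> on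
  \<open>X\<^sub>i\<^sub>,\<^sub>i\<close>.  A raising element is an \<open>A i j\<close> with \<open>i < j\<close> and \<open>i + j \<le> 2 n\<close>.
\<close>

locale orth_highest_weight = orth_grassmann e n A c
  for e :: "nat \<Rightarrow> 'a::{ring,monoid_mult}" and n A c +
  fixes ev :: "'a \<Rightarrow> 'w::ab_group_add" and l :: "nat \<Rightarrow> complex"
  assumes ev_add: "ev (x + y) = ev x + ev y"
    and ev_left: "ev y = ev y' \<Longrightarrow> ev (x * y) = ev (x * y')"
    and ev_raising: "\<lbrakk>1 \<le> i; i < j; j \<le> 2 * n - i\<rbrakk> \<Longrightarrow> ev (A i j) = 0"
    and ev_cartan: "\<lbrakk>1 \<le> i; i \<le> n\<rbrakk> \<Longrightarrow> ev (A i (neg n i)) = ev (c (l i))"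
begin

lemma ev_zero: "ev 0 = 0"
  using ev_add[of 0 0] by simp

lemma ev_sum: "ev (\<Sum>i\<in>S. f i) = (\<Sum>i\<in>S. ev (f i))"
  by (induction S rule: infinite_finite_induct) (auto simp: ev_zero ev_add)

lemma ev_left_zero: "ev y = 0 \<Longrightarrow> ev (x * y) = 0"
  using ev_left[of y 0 x] by (simp add: ev_zero)

lemma two_choose_two: "4 * of_nat (Suc m choose 2) = (2 * of_nat (Suc m) * of_nat m :: complex)"
  by (induction m) (simp_all add: numeral_2_eq_2 algebra_simps)

text \<open>
  One step of the recursion on the rank.  Splitting off the indices \<open>p\<close> and \<open>q = -p\<close> turns \<open>Omega S\<close> into
  \<open>Omega S'\<close> plus a nilpotent element that commutes with it, so the power is given by the binomial
  theorem.  For reasons of degree, only the terms containing both \<open>e p\<close> and \<open>e q\<close> survive.  The linear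
  term yields the weight \<open>l p\<close>.  In the quadratic term the raising part \<open>a\<close> is moved to the right, where
  it annihilates the vector, and the anticommutator \<open>a b + b a = - Omega S'\<close> yields the shift
  \<open>m = n - p\<close>.
\<close>

lemma Omega_step:
  assumes p: "1 \<le> p" "p \<le> n" and m: "m = n - p"
    and S': "S' = {p + 1..2 * n - p}" and S: "S = {p..2 * n + 1 - p}"
  shows "ev (Omega S ^ Suc m) = ev (c (2 * of_nat (Suc m) * (l p + of_nat m)) *
    (e p * e (neg n p) * Omega S' ^ m))"
proof -
  define q where "q = neg n p"
  have q: "q = 2 * n + 1 - p" by (simp add: q_def neg_def)
  have fin: "finite S'" and card: "card S' = 2 * m" using p by (auto simp: S' m)
  have S'n: "S' \<subseteq> {1..2 * n}" "neg n ` S' \<subseteq> S'" and pn: "p \<in> {1..2 * n}" "p \<notin> S'"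
    and qn: "q \<in> {1..2 * n}" "q \<notin> S'" "p \<noteq> q"
    using p by (auto simp: S' q neg_def)
  have SS: "S = insert p (insert q S')" using p by (auto simp: S S' q)
  define a where "a = contraction S' p"
  define b where "b = contraction S' q"
  define N0 where "N0 = e p * a + e q * b + e p * e q * A p q"
  \<comment> \<open>Rules that move every \<open>e\<close> to the left, and \<open>e p\<close> in front of \<open>e q\<close>.\<close>
  have ae: "a * e i = - (e i * a)" "b * e i = - (e i * b)" for i
    by (simp_all add: a_def b_def contraction_e)
  have left_normal': "a * (e i * z) = - (e i * (a * z))" "b * (e i * z) = - (e i * (b * z))"
    "e i * (e i * z) = 0" "e q * (e p * z) = - (e p * (e q * z))" for i z
    by (simp_all add: mult.assoc[symmetric] ae square anticommute[of q p])
  note pq_left_normal = left_normal left_normal' ae square anticommute[of q p]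
  have ab: "a * b = - Omega S' - b * a"
    using contraction_anticommutator[OF S'n pn] by (simp add: a_def b_def q_def algebra_simps eq_neg_iff_add_eq_0)
  have NN: "N0 * N0 = e p * (e q * (Omega S' + c 2 * (b * a)))"
  proof -
    have "N0 * N0 = e p * (e q * (b * a)) - e p * (e q * (a * b))"
      unfolding N0_def by (simp add: pq_left_normal distrib_left distrib_right)
    also have "\<dots> = e p * (e q * (Omega S' + c 2 * (b * a)))"
      unfolding ab c_two by (simp add: algebra_simps)
    finally show ?thesis .
  qed
  have NNN: "N0 * N0 * N0 = 0"
    unfolding NN unfolding N0_def by (simp add: distrib_left distrib_right pq_left_normal Omega_e c_two)
      (simp add: mult.assoc[symmetric] Omega_e, simp add: pq_left_normal)
  have Nc: "N0 * c x = c x * N0" for x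
    by (simp add: N0_def a_def b_def distrib_left distrib_right mult.assoc contraction_c c_A left_comm)
  have ON: "Omega S' * N0 = N0 * Omega S'"
  proof -
    have A: "A p q * Omega S' = Omega S' * A p q"
      using Omega_A_commute[OF S'n(1) pn] qn by (simp add: q_def)
    have l: "Omega S' * (e i * z) = e i * (Omega S' * z)" for i z
      by (simp add: mult.assoc[symmetric] Omega_e)
    show ?thesis
      using contraction_Omega_commute[OF S'n pn] contraction_Omega_commute[OF S'n qn(1,2)]
      by (simp add: N0_def distrib_left distrib_right mult.assoc l A a_def b_def)
  qed
  \<comment> \<open>The degrees \<open>2 m + 1\<close> and \<open>2 m + 2\<close> exceed the number \<open>2 m\<close> of available indices.\<close>
  have top: "Omega S' ^ m * contraction S' i = 0" for i
  proof -
    have "Omega S' ^ m * (e j * A i j) = 0" if "j \<in> S'" for j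
      using Omega_power_eprod_zero[OF fin, of "[j]" m] card that by (simp add: mult.assoc[symmetric])
    then show ?thesis by (simp add: contraction_def sum_distrib_left)
  qed
  have top': "Omega S' ^ Suc m = 0"
    using Omega_power_eprod_zero[OF fin, of "[]" "Suc m"] card by simp
  have lO: "Omega S' ^ k * (e i * z) = e i * (Omega S' ^ k * z)"
    "Omega S' ^ k * (c x * z) = c x * (Omega S' ^ k * z)" for i z k x
    by (simp_all add: mult.assoc[symmetric] Omega_power_e Omega_power_c)
  have "Omega S ^ Suc m = (Omega S' + c 2 * N0) ^ Suc m"
    unfolding SS using fin pn(2) qn(2,3)
    by (subst Omega_insert) (auto simp: N0_def a_def b_def distrib_left)
  also have "\<dots> = Omega S' ^ Suc m + c (of_nat (Suc m)) * (Omega S' ^ (Suc m - 1) * (c 2 * N0)) +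
    c (of_nat (Suc m choose 2)) * (Omega S' ^ (Suc m - 2) * (c 2 * N0 * (c 2 * N0)))"
  proof (rule binomial_nilpotent)
    have lN: "N0 * (c x * z) = c x * (N0 * z)" for x z
      by (simp add: mult.assoc[symmetric] Nc)
    show "Omega S' * (c 2 * N0) = c 2 * N0 * Omega S'"
      by (simp add: mult.assoc[symmetric] Omega_c) (simp add: mult.assoc ON)
    show "c 2 * N0 * (c 2 * N0) * (c 2 * N0) = 0"
      using NNN by (simp add: mult.assoc lN)
    show "c 2 * N0 * c x = c x * (c 2 * N0)" for x
      by (simp add: mult.assoc Nc) (simp add: mult.assoc[symmetric] c_mult[symmetric] mult.commute)
  qed (rule Omega_c)
  also have "c 2 * N0 * (c 2 * N0) = c 4 * (e p * (e q * (Omega S' + c 2 * (b * a))))"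
  proof -
    have "c 2 * N0 * (c 2 * N0) = c 2 * (N0 * c 2) * N0" by (simp add: mult.assoc)
    also have "\<dots> = c 4 * (N0 * N0)" unfolding Nc by (simp add: mult.assoc c_c)
    finally show ?thesis by (simp add: NN)
  qed
  also have "Omega S' ^ (Suc m - 1) * (c 2 * N0) = c 2 * (e p * (e q * (Omega S' ^ m * A p q)))"
    by (simp add: N0_def distrib_left a_def b_def lO top mult.assoc)
  finally have "Omega S ^ Suc m = c (2 * of_nat (Suc m)) * (e p * (e q * (Omega S' ^ m * A p q))) +
      c (4 * of_nat (Suc m choose 2)) * (e p * (e q * (Omega S' ^ (m - 1) * (Omega S' + c 2 * (b * a)))))"
    by (simp only: top' lO c_c) (simp add: mult.commute)
  also have "c (4 * of_nat (Suc m choose 2)) * (e p * (e q * (Omega S' ^ (m - 1) * (Omega S' + c 2 * (b * a))))) =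
      c (2 * of_nat (Suc m) * of_nat m) * (e p * (e q * (Omega S' ^ m))) +
      (c (4 * of_nat (Suc m choose 2)) * (e p * (e q * (Omega S' ^ (m - 1) * (c 2 * b))))) * a"
    unfolding two_choose_two
    by (cases m) (simp_all add: c_zero distrib_left mult.assoc power_Suc2 del: power_Suc)
  finally have Om: "Omega S ^ Suc m = (c (2 * of_nat (Suc m)) * (e p * (e q * Omega S' ^ m))) * A p q +
      c (2 * of_nat (Suc m) * of_nat m) * (e p * (e q * (Omega S' ^ m))) +
      (c (4 * of_nat (Suc m choose 2)) * (e p * (e q * (Omega S' ^ (m - 1) * (c 2 * b))))) * a"
    by (simp only: mult.assoc add.assoc)
  have "ev a = 0"
    unfolding a_def contraction_def ev_sum
    using p by (intro sum.neutral ballI ev_left_zero ev_raising) (auto simp: S')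
  moreover have "ev (A p q) = ev (c (l p))" unfolding q_def using p by (rule ev_cartan)
  ultimately have "ev (Omega S ^ Suc m) = ev ((c (2 * of_nat (Suc m)) * (e p * (e q * Omega S' ^ m))) * c (l p)) +
      ev (c (2 * of_nat (Suc m) * of_nat m) * (e p * (e q * (Omega S' ^ m))))"
    unfolding Om ev_add by (simp add: ev_left_zero ev_left[of "A p q" "c (l p)"])
  also have "\<dots> = ev (c (2 * of_nat (Suc m) * (l p + of_nat m)) * (e p * e q * Omega S' ^ m))"
    unfolding ev_add[symmetric] distrib_left c_add distrib_right
    by (simp only: mult.assoc Omega_power_c left_comm c_e c_c)
  finally show ?thesis by (simp add: q_def)
qed

lemma ev_Omega_power:
  "m \<le> n \<Longrightarrow> ev (Omega {n - m + 1..n + m} ^ m) =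
    ev (c (2 ^ m * fact m * (\<Prod>i=n - m + 1..n. l i + of_nat n - of_nat i)) * eprod [n - m + 1..<n + m + 1])"
proof (induction m)
  case 0
  then show ?case by (simp add: c_one)
next
  case (Suc m)
  define p where "p = n - m"
  have p: "1 \<le> p" "p \<le> n" "m = n - p" using Suc.prems by (auto simp: p_def)
  let ?r = "2 ^ m * fact m * (\<Prod>i=n - m + 1..n. l i + of_nat n - of_nat i)"
  let ?xs = "[n - m + 1..<n + m + 1]"
  let ?k = "2 * of_nat (Suc m) * (l p + of_nat m)"
  have sets: "{n - m + 1..n + m} = {p + 1..2 * n - p}" "{n - Suc m + 1..n + Suc m} = {p..2 * n + 1 - p}"
    using p by auto
  have "ev (Omega {n - Suc m + 1..n + Suc m} ^ Suc m) =
      ev (c ?k * (e p * e (neg n p) * Omega {n - m + 1..n + m} ^ m))"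
    unfolding sets by (rule Omega_step[OF p refl refl])
  also have "\<dots> = ev (c ?k * (e p * e (neg n p)) * (c ?r * eprod ?xs))"
    using ev_left[OF Suc.IH[OF Suc_leD[OF Suc.prems]], of "c ?k * (e p * e (neg n p))"]
    by (simp only: mult.assoc)
  also have "c ?k * (e p * e (neg n p)) * (c ?r * eprod ?xs) = c (?k * ?r) * (e p * (e (neg n p) * eprod ?xs))"
    by (simp add: mult.assoc left_comm c_c)
  also have "e (neg n p) * eprod ?xs = eprod ?xs * e (neg n p)"
    using Suc.prems by (simp add: eprod_move)
  also have "e p * (eprod ?xs * e (neg n p)) = eprod (p # ?xs @ [neg n p])" by simp
  also have "p # ?xs @ [neg n p] = [n - Suc m + 1..<n + Suc m + 1]"
  proof -
    have "neg n p = n + m + 1" using p by (simp add: neg_def)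
    moreover have "[n - Suc m + 1..<n + Suc m + 1] = p # [n - m + 1..<n + Suc m + 1]"
      using p by (subst upt_conv_Cons) auto
    moreover have "[n - m + 1..<n + Suc m + 1] = ?xs @ [n + m + 1]" by simp
    ultimately show ?thesis by simp
  qed
  also have "?k * ?r = 2 ^ Suc m * fact (Suc m) * (\<Prod>i=n - Suc m + 1..n. l i + of_nat n - of_nat i)"
  proof -
    have "{n - Suc m + 1..n} = insert p {n - m + 1..n}" using p by auto
    then have "(\<Prod>i=n - Suc m + 1..n. l i + of_nat n - of_nat i) =
        (l p + of_nat n - of_nat p) * (\<Prod>i=n - m + 1..n. l i + of_nat n - of_nat i)"
      by (simp add: p_def)
    also have "l p + of_nat n - of_nat p = l p + of_nat m" using p by (simp add: of_nat_diff)
    finally show ?thesis by (simp only: power_Suc fact_Suc mult_ac)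
  qed
  finally show ?case .
qed

theorem ev_pfaffian_sum:
  "ev (\<Sum>\<sigma> | \<sigma> permutes {1..2 * n}. c (of_int (sign \<sigma>)) * (eprod [1..<2 * n + 1] * word n \<sigma>)) =
    ev (c (2 ^ n * fact n * (\<Prod>i=1..n. l i + of_nat n - of_nat i)) * eprod [1..<2 * n + 1])"
  unfolding Omega_power_permutes[symmetric] using ev_Omega_power[of n] by (simp add: mult_2)

end

section \<open>Congruence modulo the defining ideal\<close>

text \<open>
  Identities in the enveloping algebra are derived for representatives in the free algebra, where sums
  and products are those of the type classes.
\<close>

definition uea_cong :: "nat \<Rightarrow> free \<Rightarrow> free \<Rightarrow> bool" where
  "uea_cong n p q \<longleftrightarrow> p - q \<in> uea_ideal n"

lemma free_alg_simps [simp]: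
  "mult (free_alg n) = (*)" "one (free_alg n) = 1" "zero (free_alg n) = 0" "add (free_alg n) = (+)"
  by (simp_all add: free_alg_def)

lemma uea_ideal_zero: "0 \<in> uea_ideal n"
  using additive_subgroup.zero_closed[OF ideal.axioms(1)[OF ideal_uea_ideal]] by simp

lemma uea_ideal_add: "p \<in> uea_ideal n \<Longrightarrow> q \<in> uea_ideal n \<Longrightarrow> p + q \<in> uea_ideal n"
  using additive_subgroup.a_closed[OF ideal.axioms(1)[OF ideal_uea_ideal]] by simp

lemma uea_ideal_mult:
  assumes "p \<in> uea_ideal n" "q \<in> carrier (free_alg n)"
  shows "q * p \<in> uea_ideal n" "p * q \<in> uea_ideal n"
  using ideal.I_l_closed[OF ideal_uea_ideal assms] ideal.I_r_closed[OF ideal_uea_ideal assms] by simp_all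

lemma const_simps: "const 1 = 1" "const 0 = 0" "const (x + y) = const x + const y"
  "const (x * y) = const x * const y" "const (- x) = - const x"
  by (simp_all add: const_def single_add mult_single single_one zero_list_def[symmetric] single_uminus)

lemma const_commute: "p * const x = const x * p"
proof -
  have "Poly_Mapping.single w y * const x = const x * Poly_Mapping.single w y" for w y
    by (simp add: const_def mult_single plus_list_def mult.commute)
  then have "(\<Sum>w\<in>Poly_Mapping.keys p. Poly_Mapping.single w (Poly_Mapping.lookup p w)) * const x =
      const x * (\<Sum>w\<in>Poly_Mapping.keys p. Poly_Mapping.single w (Poly_Mapping.lookup p w))"
    by (simp add: sum_distrib_left sum_distrib_right)
  then show ?thesis unfolding free_decomp[symmetric] .
qed

lemma uea_ideal_uminus: "p \<in> uea_ideal n \<Longrightarrow> - p \<in> uea_ideal n"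
  using uea_ideal_mult(1)[OF _ const_closed, of p n "- 1"] by (simp add: const_simps)

lemma uea_cong_refl: "uea_cong n p p"
  by (simp add: uea_cong_def uea_ideal_zero)

lemma uea_cong_trans [trans]: "uea_cong n p q \<Longrightarrow> uea_cong n q r \<Longrightarrow> uea_cong n p r"
  using uea_ideal_add[of "p - q" n "q - r"] by (simp add: uea_cong_def)

lemma uea_cong_sym: "uea_cong n p q \<Longrightarrow> uea_cong n q p"
  using uea_ideal_uminus[of "p - q" n] by (simp add: uea_cong_def)

lemma uea_cong_add: "uea_cong n p q \<Longrightarrow> uea_cong n r s \<Longrightarrow> uea_cong n (p + r) (q + s)"
  using uea_ideal_add[of "p - q" n "r - s"] by (simp add: uea_cong_def algebra_simps)

lemma uea_cong_mult_left:
  "uea_cong n p q \<Longrightarrow> r \<in> carrier (free_alg n) \<Longrightarrow> uea_cong n (r * p) (r * q)"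
  using uea_ideal_mult(1)[of "p - q" n r] by (simp add: uea_cong_def right_diff_distrib)

lemma uea_cong_mult_right:
  "uea_cong n p q \<Longrightarrow> r \<in> carrier (free_alg n) \<Longrightarrow> uea_cong n (p * r) (q * r)"
  using uea_ideal_mult(2)[of "p - q" n r] by (simp add: uea_cong_def left_diff_distrib)

lemma uea_cong_sum:
  "(\<And>s. s \<in> S \<Longrightarrow> uea_cong n (f s) (g s)) \<Longrightarrow> uea_cong n (\<Sum>s\<in>S. f s) (\<Sum>s\<in>S. g s)"
  by (induction S rule: infinite_finite_induct) (auto intro: uea_cong_refl uea_cong_add)

lemma relation_in_ideal: "r \<in> uea_relations n \<Longrightarrow> r \<in> uea_ideal n"
  unfolding uea_ideal_def
  using ring.genideal_self[OF ring_free_alg uea_relations_closed] by blast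

lemma gen_add: "x \<in> orth n \<Longrightarrow> y \<in> orth n \<Longrightarrow> uea_cong n (gen (x + y)) (gen x + gen y)"
  unfolding uea_cong_def by (rule relation_in_ideal, unfold uea_relations_def, blast)

lemma gen_smult: "x \<in> orth n \<Longrightarrow> uea_cong n (gen (z \<cdot>\<^sub>m x)) (const z * gen x)"
  unfolding uea_cong_def by (rule relation_in_ideal, unfold uea_relations_def, blast)

lemma gen_bracket:
  "x \<in> orth n \<Longrightarrow> y \<in> orth n \<Longrightarrow> uea_cong n (gen (bracket x y)) (gen x * gen y - gen y * gen x)"
  unfolding uea_cong_def by (rule relation_in_ideal, unfold uea_relations_def, blast)

text \<open>
  Linear relations between matrices, checked entrywise, hold in the enveloping algebra.
\<close>

lemma gen_linear_combination:
  assumes "finite S" "Y \<in> orth n" "\<And>s. s \<in> S \<Longrightarrow> f s \<in> orth n"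
    and "\<And>a b. a < 2 * n \<Longrightarrow> b < 2 * n \<Longrightarrow> Y $$ (a, b) = (\<Sum>s\<in>S. h s * f s $$ (a, b))"
  shows "uea_cong n (gen Y) (\<Sum>s\<in>S. const (h s) * gen (f s))"
  using assms
proof (induction S arbitrary: Y rule: finite_induct)
  case empty
  have "Y \<in> carrier_mat (2 * n) (2 * n)" using orth_carrier[OF empty(1)] .
  then have "0 \<cdot>\<^sub>m Y = Y" using empty(3) by (intro eq_matI) auto
  then have "uea_cong n (gen Y) (const 0 * gen Y)" using gen_smult[OF empty(1), of 0] by simp
  then show ?case by (simp add: const_simps)
next
  case (insert s S)
  have f: "f s \<in> orth n" using insert by simp
  define Z where "Z = Y + (- h s) \<cdot>\<^sub>m f s"
  have Z: "Z \<in> orth n" unfolding Z_def by (intro orth_add orth_smult insert f)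
  have car: "Y \<in> carrier_mat (2 * n) (2 * n)" "f s \<in> carrier_mat (2 * n) (2 * n)"
    using orth_carrier[OF insert(4)] orth_carrier[OF f] .
  have "uea_cong n (gen Z) (\<Sum>s\<in>S. const (h s) * gen (f s))"
    by (rule insert.IH[OF Z]) (use insert car in \<open>auto simp: Z_def\<close>)
  moreover have "uea_cong n (gen Y) (gen Z + const (h s) * gen (f s))"
  proof -
    have "Y = Z + h s \<cdot>\<^sub>m f s" using car by (intro eq_matI) (auto simp: Z_def)
    then have "uea_cong n (gen Y) (gen Z + gen (h s \<cdot>\<^sub>m f s))"
      using gen_add[OF Z orth_smult[OF f]] by simp
    then show ?thesis
      by (rule uea_cong_trans) (intro uea_cong_add uea_cong_refl gen_smult f)
  qed
  ultimately have "uea_cong n (gen Y) ((\<Sum>s\<in>S. const (h s) * gen (f s)) + const (h s) * gen (f s))"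
    by (meson uea_cong_trans uea_cong_add uea_cong_refl)
  then show ?case using insert by (simp add: add.commute)
qed

text \<open>
  The entry \<open>X\<^sub>i\<^sub>,\<^sub>-\<^sub>j\<close> of the alternating matrix whose Pfaffian is taken.
\<close>

definition Xt :: "nat \<Rightarrow> nat \<Rightarrow> nat \<Rightarrow> complex mat" where
  "Xt n i j = X n i (neg n j)"

lemma Xt_orth: "i \<in> {1..2 * n} \<Longrightarrow> j \<in> {1..2 * n} \<Longrightarrow> Xt n i j \<in> orth n"
  unfolding Xt_def by (intro X_closed neg_in)

lemma Xt_entry:
  assumes "j \<in> {1..2 * n}" "a < 2 * n" "b < 2 * n"
  shows "Xt n i j $$ (a, b) = of_bool (a + 1 = i \<and> neg n (b + 1) = j) - of_bool (a + 1 = j \<and> neg n (b + 1) = i)"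
proof -
  have "b + 1 = neg n j \<longleftrightarrow> neg n (b + 1) = j" using assms by (auto simp: neg_def)
  moreover have "b + 1 = neg n i \<longleftrightarrow> neg n (b + 1) = i" if "a + 1 = j"
    using assms by (auto simp: neg_def)
  ultimately show ?thesis using assms(2,3) neg_neg[OF assms(1)]
    by (auto simp: Xt_def X_def E_def)
qed

lemma sum_of_bool_mult:
  assumes "finite S"
  shows "(\<Sum>m\<in>S. f m * (of_bool (P \<and> u = m) :: complex)) = (if P \<and> u \<in> S then f u else 0)"
  using assms by (cases P) (auto simp: of_bool_def if_distrib cong: if_cong)

text \<open>
  Under the adjoint action, \<open>Xt n k l\<close> transforms like the exterior product of the \<open>k\<close>-th and the \<open>l\<close>-th
  standard basis vector.
\<close>

lemma bracket_Xt:
  assumes g: "g \<in> orth n" and k: "k \<in> {1..2 * n}" and l: "l \<in> {1..2 * n}" and ab: "a < 2 * n" "b < 2 * n"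
  shows "bracket g (Xt n k l) $$ (a, b) = (\<Sum>m\<in>{1..2 * n}.
    g $$ (m - 1, k - 1) * Xt n m l $$ (a, b) + g $$ (m - 1, l - 1) * Xt n k m $$ (a, b))"
proof -
  have gc: "g \<in> carrier_mat (2 * n) (2 * n)" and xc: "Xt n k l \<in> carrier_mat (2 * n) (2 * n)"
    using g Xt_orth[OF k l] by (auto dest: orth_carrier)
  let ?b = "neg n (b + 1)"
  have b: "?b \<in> {1..2 * n}" "?b - 1 = 2 * n - Suc b" using ab by (auto simp: neg_def)
  have r: "sum f {0..<2 * n} = (\<Sum>m\<in>{1..2 * n}. f (m - 1))" for f :: "nat \<Rightarrow> complex"
    by (rule sum.reindex_bij_witness[of _ "\<lambda>m. m - 1" Suc]) auto
  have 1: "(g * Xt n k l) $$ (a, b) = of_bool (?b = l) * g $$ (a, k - 1) - of_bool (?b = k) * g $$ (a, l - 1)"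
  proof -
    have "(g * Xt n k l) $$ (a, b) = (\<Sum>m\<in>{1..2 * n}. g $$ (a, m - 1) * Xt n k l $$ (m - 1, b))"
      using gc xc ab by (simp add: scalar_prod_def r)
    also have "\<dots> = (\<Sum>m\<in>{1..2 * n}. g $$ (a, m - 1) * of_bool (?b = l \<and> k = m) -
        g $$ (a, m - 1) * of_bool (?b = k \<and> l = m))"
      using ab l by (intro sum.cong refl) (auto simp: Xt_entry right_diff_distrib)
    finally show ?thesis using k l by (simp add: sum_subtractf sum_of_bool_mult)
  qed
  have 2: "(Xt n k l * g) $$ (a, b) = of_bool (a + 1 = k) * g $$ (neg n l - 1, b) - of_bool (a + 1 = l) * g $$ (neg n k - 1, b)"
  proof -
    have "(Xt n k l * g) $$ (a, b) = (\<Sum>m\<in>{1..2 * n}. Xt n k l $$ (a, m - 1) * g $$ (m - 1, b))"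
      using gc xc ab by (simp add: scalar_prod_def r)
    also have "\<dots> = (\<Sum>m\<in>{1..2 * n}. g $$ (m - 1, b) * of_bool (a + 1 = k \<and> neg n l = m) -
        g $$ (m - 1, b) * of_bool (a + 1 = l \<and> neg n k = m))"
    proof (intro sum.cong refl)
      fix m assume m: "m \<in> {1..2 * n}"
      have m1: "m - 1 < 2 * n" using m by auto
      have "neg n m = l \<longleftrightarrow> neg n l = m" "neg n m = k \<longleftrightarrow> neg n k = m"
        using m k l by (auto simp: neg_def)
      then show "Xt n k l $$ (a, m - 1) * g $$ (m - 1, b) = g $$ (m - 1, b) * of_bool (a + 1 = k \<and> neg n l = m) -
        g $$ (m - 1, b) * of_bool (a + 1 = l \<and> neg n k = m)"
        using Xt_entry[OF l ab(1) m1, of k] m by (simp add: right_diff_distrib mult.commute)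
    qed
    finally show ?thesis using neg_in[OF k] neg_in[OF l] by (simp add: sum_subtractf sum_of_bool_mult)
  qed
  have flip: "g $$ (neg n i - 1, b) = - g $$ (?b - 1, i - 1)" if "i \<in> {1..2 * n}" for i
  proof -
    have "neg n i - 1 = 2 * n - Suc (i - 1)" "i - 1 < 2 * n" using that by (auto simp: neg_def)
    then show ?thesis using orthD[OF g, of "i - 1" b] ab b by simp
  qed
  have a: "a + 1 \<in> {1..2 * n}" using ab by auto
  have 3: "(\<Sum>m\<in>{1..2 * n}. g $$ (m - 1, k - 1) * Xt n m l $$ (a, b)) =
      of_bool (?b = l) * g $$ (a, k - 1) - of_bool (a + 1 = l) * g $$ (?b - 1, k - 1)"
  proof -
    have "(\<Sum>m\<in>{1..2 * n}. g $$ (m - 1, k - 1) * Xt n m l $$ (a, b)) =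
      (\<Sum>m\<in>{1..2 * n}. g $$ (m - 1, k - 1) * of_bool (?b = l \<and> a + 1 = m) -
        g $$ (m - 1, k - 1) * of_bool (a + 1 = l \<and> ?b = m))"
      using ab l by (intro sum.cong refl) (auto simp: Xt_entry right_diff_distrib)
    then show ?thesis using a b(1) by (auto simp: sum_subtractf sum_of_bool_mult) (metis diff_Suc_1 One_nat_def)
  qed
  have 4: "(\<Sum>m\<in>{1..2 * n}. g $$ (m - 1, l - 1) * Xt n k m $$ (a, b)) =
      of_bool (a + 1 = k) * g $$ (?b - 1, l - 1) - of_bool (?b = k) * g $$ (a, l - 1)"
  proof -
    have "(\<Sum>m\<in>{1..2 * n}. g $$ (m - 1, l - 1) * Xt n k m $$ (a, b)) =
      (\<Sum>m\<in>{1..2 * n}. g $$ (m - 1, l - 1) * of_bool (a + 1 = k \<and> ?b = m) -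
        g $$ (m - 1, l - 1) * of_bool (?b = k \<and> a + 1 = m))"
      using ab by (intro sum.cong refl) (auto simp: Xt_entry right_diff_distrib)
    then show ?thesis using a b(1) by (auto simp: sum_subtractf sum_of_bool_mult)
  qed
  have "bracket g (Xt n k l) $$ (a, b) = (g * Xt n k l) $$ (a, b) - (Xt n k l * g) $$ (a, b)"
    using gc xc ab by (simp add: bracket_def del: index_mult_mat(1))
  then show ?thesis
    unfolding sum.distrib 1 2 3 4 flip[OF k] flip[OF l] by simp
qed

lemma sum_times_bool:
  "(\<Sum>s\<in>S \<times> (UNIV :: bool set). F s) = (\<Sum>m\<in>S. F (m, True) + F (m, False))"
  using sum.cartesian_product[of "\<lambda>m t. F (m, t)" "UNIV :: bool set" S]
  by (simp add: UNIV_bool add.commute)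

lemma gen_commutator_Xt:
  assumes g: "g \<in> orth n" and k: "k \<in> {1..2 * n}" and l: "l \<in> {1..2 * n}"
  shows "uea_cong n (gen g * gen (Xt n k l) - gen (Xt n k l) * gen g)
    (\<Sum>m\<in>{1..2 * n}. const (g $$ (m - 1, k - 1)) * gen (Xt n m l) +
      const (g $$ (m - 1, l - 1)) * gen (Xt n k m))"
proof -
  \<comment> \<open>The Boolean component tells the two families of summands apart.\<close>
  let ?S = "{1..2 * n} \<times> (UNIV :: bool set)"
  let ?h = "\<lambda>(m, t). if t then g $$ (m - 1, k - 1) else g $$ (m - 1, l - 1)"
  let ?f = "\<lambda>(m, t). if t then Xt n m l else Xt n k m"
  have "uea_cong n (gen (bracket g (Xt n k l))) (\<Sum>s\<in>?S. const (?h s) * gen (?f s))"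
  proof (rule gen_linear_combination)
    show "bracket g (Xt n k l) \<in> orth n" by (intro orth_bracket g Xt_orth k l)
    show "?f s \<in> orth n" if "s \<in> ?S" for s using that k l by (auto intro: Xt_orth simp del: atLeastAtMost_iff One_nat_def)
    show "bracket g (Xt n k l) $$ (a, b) = (\<Sum>s\<in>?S. ?h s * ?f s $$ (a, b))"
      if "a < 2 * n" "b < 2 * n" for a b
      unfolding bracket_Xt[OF g k l that]
      unfolding sum_times_bool by simp
  qed simp
  also have "(\<Sum>s\<in>?S. const (?h s) * gen (?f s)) = (\<Sum>m\<in>{1..2 * n}. const (g $$ (m - 1, k - 1)) * gen (Xt n m l) +
      const (g $$ (m - 1, l - 1)) * gen (Xt n k m))"
    unfolding sum_times_bool by simp
  finally show ?thesis
    using uea_cong_trans[OF uea_cong_sym[OF gen_bracket[OF g Xt_orth[OF k l]]]] by blast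
qed

section \<open>Centrality\<close>

text \<open>
  The product of the \<open>m\<close> generators \<open>Xt n (i 1) (i 2)\<close>, \<open>Xt n (i 3) (i 4)\<close>, \<open>\<dots>\<close> attached to an index
  sequence \<open>i\<close>.
\<close>

definition pf_word :: "nat \<Rightarrow> nat \<Rightarrow> (nat \<Rightarrow> nat) \<Rightarrow> free" where
  "pf_word n m i = prod_list (map (\<lambda>k. gen (Xt n (i (2 * k - 1)) (i (2 * k)))) [1..<m + 1])"

lemma pf_word_cong:
  "(\<And>k. k \<in> {1..2 * m} \<Longrightarrow> i k = i' k) \<Longrightarrow> pf_word n m i = pf_word n m i'"
  unfolding pf_word_def
proof (intro arg_cong[of _ _ prod_list] map_cong refl)
  fix k assume *: "\<And>k. k \<in> {1..2 * m} \<Longrightarrow> i k = i' k" and "k \<in> set [1..<m + 1]"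
  then have "2 * k - 1 \<in> {1..2 * m}" "2 * k \<in> {1..2 * m}" by auto
  then show "gen (Xt n (i (2 * k - 1)) (i (2 * k))) = gen (Xt n (i' (2 * k - 1)) (i' (2 * k)))"
    by (simp only: *)
qed

lemma pf_word_Suc: "pf_word n (Suc m) i = pf_word n m i * gen (Xt n (i (2 * m + 1)) (i (2 * m + 2)))"
  by (simp add: pf_word_def)

lemma one_closed: "1 \<in> carrier (free_alg n)"
  using const_closed[of 1 n] by (simp add: const_simps)

lemma sum_closed: "(\<And>s. s \<in> S \<Longrightarrow> f s \<in> carrier (free_alg n)) \<Longrightarrow> (\<Sum>s\<in>S. f s) \<in> carrier (free_alg n)"
proof (induction S rule: infinite_finite_induct)
  case (insert s S)
  then show ?case by (simp add: free_closed(1))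
qed (use const_closed[of 0 n] in \<open>simp_all add: const_simps\<close>)

lemma pf_word_closed:
  "(\<And>k. k \<in> {1..2 * m} \<Longrightarrow> i k \<in> {1..2 * n}) \<Longrightarrow> pf_word n m i \<in> carrier (free_alg n)"
proof (induction m)
  case 0
  then show ?case by (simp add: pf_word_def one_closed)
next
  case (Suc m)
  have "i (2 * m + 1) \<in> {1..2 * n}" "i (2 * m + 2) \<in> {1..2 * n}" by (intro Suc.prems; simp)+
  then show ?case unfolding pf_word_Suc
    by (intro free_closed gen_closed Xt_orth Suc.IH Suc.prems) auto
qed

text \<open>
  The Leibniz rule: the commutator with \<open>g\<close> applies \<open>g\<close> to each of the \<open>2 m\<close> indices in turn.
\<close>

lemma gen_commutator_pf_word:
  assumes g: "g \<in> orth n"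
  shows "(\<And>k. k \<in> {1..2 * m} \<Longrightarrow> i k \<in> {1..2 * n}) \<Longrightarrow>
    uea_cong n (gen g * pf_word n m i - pf_word n m i * gen g)
      (\<Sum>p\<in>{1..2 * m}. \<Sum>k\<in>{1..2 * n}. const (g $$ (k - 1, i p - 1)) * pf_word n m (i(p := k)))"
proof (induction m)
  case 0
  then show ?case by (simp add: pf_word_def uea_cong_refl)
next
  case (Suc m)
  let ?x = "i (2 * m + 1)" and ?y = "i (2 * m + 2)"
  let ?W = "pf_word n m i" and ?Y = "gen (Xt n ?x ?y)"
  let ?c = "\<lambda>k p. const (g $$ (k - 1, i p - 1))"
  have xy: "?x \<in> {1..2 * n}" "?y \<in> {1..2 * n}" by (intro Suc.prems; simp)+
  have i: "i k \<in> {1..2 * n}" if "k \<in> {1..2 * m}" for k using that by (intro Suc.prems) simp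
  have "gen g * pf_word n (Suc m) i - pf_word n (Suc m) i * gen g =
      (gen g * ?W - ?W * gen g) * ?Y + ?W * (gen g * ?Y - ?Y * gen g)"
    unfolding pf_word_Suc by (simp add: algebra_simps)
  moreover have "uea_cong n \<dots>
     ((\<Sum>p\<in>{1..2 * m}. \<Sum>k\<in>{1..2 * n}. ?c k p * pf_word n m (i(p := k))) * ?Y +
      ?W * (\<Sum>k\<in>{1..2 * n}. ?c k (2 * m + 1) * gen (Xt n k ?y) + ?c k (2 * m + 2) * gen (Xt n ?x k)))"
    by (intro uea_cong_add uea_cong_mult_left uea_cong_mult_right gen_closed Xt_orth xy
        Suc.IH pf_word_closed i gen_commutator_Xt g)
  moreover have "(\<Sum>p\<in>{1..2 * m}. \<Sum>k\<in>{1..2 * n}. ?c k p * pf_word n m (i(p := k))) * ?Y =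
      (\<Sum>p\<in>{1..2 * m}. \<Sum>k\<in>{1..2 * n}. ?c k p * pf_word n (Suc m) (i(p := k)))"
    unfolding sum_distrib_right
    by (intro sum.cong refl) (simp add: pf_word_Suc mult.assoc)
  moreover have "?W * (\<Sum>k\<in>{1..2 * n}. ?c k (2 * m + 1) * gen (Xt n k ?y) + ?c k (2 * m + 2) * gen (Xt n ?x k)) =
      (\<Sum>k\<in>{1..2 * n}. ?c k (2 * m + 1) * pf_word n (Suc m) (i(2 * m + 1 := k))) +
      (\<Sum>k\<in>{1..2 * n}. ?c k (2 * m + 2) * pf_word n (Suc m) (i(2 * m + 2 := k)))"
  proof -
    have 1: "pf_word n m (i(2 * m + 1 := k)) = ?W" "pf_word n m (i(2 * m + 2 := k)) = ?W" for k
      by (rule pf_word_cong, simp)+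
    have 2: "?W * (const z * u) = const z * (?W * u)" for z u
      by (simp add: mult.assoc[symmetric] const_commute)
    show ?thesis unfolding sum_distrib_left sum.distrib[symmetric] pf_word_Suc 1
      by (simp add: distrib_left 2)
  qed
  moreover have "(\<Sum>p\<in>{1..2 * Suc m}. F p) = (\<Sum>p\<in>{1..2 * m}. F p) + (F (2 * m + 1) + F (2 * m + 2))" for F :: "nat \<Rightarrow> free"
    by (simp add: add.assoc)
  ultimately show ?case by (simp only:)
qed

text \<open>
  The Pfaffian without its normalising factor.
\<close>

definition pf_sum :: "nat \<Rightarrow> free" where
  "pf_sum n = (\<Sum>\<sigma> | \<sigma> permutes {1..2 * n}. const (of_int (sign \<sigma>)) * pf_word n n \<sigma>)"

lemma sum_antisymmetric:
  fixes H :: "'b \<Rightarrow> 'b \<Rightarrow> free"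
  assumes "\<And>p q. p \<in> S \<Longrightarrow> q \<in> S \<Longrightarrow> p \<noteq> q \<Longrightarrow> H p q = - H q p" "finite S"
  shows "(\<Sum>p\<in>S. \<Sum>q\<in>S. H p q) = (\<Sum>p\<in>S. H p p)"
proof -
  define K where "K p q = (if p = q then 0 else H p q)" for p q
  let ?T = "\<Sum>p\<in>S. \<Sum>q\<in>S. K p q"
  have "?T = (\<Sum>p\<in>S. \<Sum>q\<in>S. K q p)" by (rule sum.swap)
  also have "\<dots> = (\<Sum>p\<in>S. \<Sum>q\<in>S. - K p q)"
  proof (intro sum.cong refl)
    fix p q assume "p \<in> S" "q \<in> S"
    then show "K q p = - K p q" using assms(1)[of q p] by (cases "p = q") (simp_all add: K_def)
  qed
  finally have "?T = - ?T" by (simp add: sum_negf)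
  then have "?T + ?T = 0" by (simp only: eq_neg_iff_add_eq_0)
  then have "const (1/2) * (const 2 * ?T) = 0"
    using const_simps(3)[of 1 1] by (simp add: const_simps(1) mult_2)
  then have T: "?T = 0" by (simp add: mult.assoc[symmetric] const_simps(4)[symmetric] const_simps(1))
  have "(\<Sum>p\<in>S. \<Sum>q\<in>S. H p q) = (\<Sum>p\<in>S. \<Sum>q\<in>S. K p q + (if p = q then H p p else 0))"
    by (intro sum.cong refl) (auto simp: K_def)
  also have "\<dots> = ?T + (\<Sum>p\<in>S. H p p)" using assms(2) by (simp add: sum.distrib)
  finally show ?thesis using T by simp
qed

lemma orth_trace:
  assumes "g \<in> orth n"
  shows "(\<Sum>k\<in>{1..2 * n}. g $$ (k - 1, k - 1)) = 0"
proof -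
  have "(\<Sum>k\<in>{1..2 * n}. g $$ (k - 1, k - 1)) = (\<Sum>k\<in>{1..2 * n}. g $$ (neg n k - 1, neg n k - 1))"
    by (rule sum.reindex_bij_witness[of _ "neg n" "neg n"]) (simp_all only: neg_neg neg_in)
  also have "\<dots> = (\<Sum>k\<in>{1..2 * n}. - g $$ (k - 1, k - 1))"
  proof (rule sum.cong[OF refl])
    fix k assume k: "k \<in> {1..2 * n}"
    have "neg n k - 1 = 2 * n - Suc (k - 1)" "2 * n - Suc (neg n k - 1) = k - 1" using k by (auto simp: neg_def)
    moreover have "k - 1 < 2 * n" "neg n k - 1 < 2 * n" using k by (auto simp: neg_def)
    ultimately show "g $$ (neg n k - 1, neg n k - 1) = - g $$ (k - 1, k - 1)"
      using orthD[OF assms, of "neg n k - 1" "k - 1"] by (simp only:)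
  qed
  finally show ?thesis by (simp add: sum_negf)
qed

text \<open>
  An alternating sum is multiplied by the trace of \<open>g\<close> when \<open>g\<close> acts on all its indices, and that trace
  is zero.  The terms in which \<open>\<sigma> p\<close> is replaced by \<open>\<sigma> q\<close>, for \<open>q \<noteq> p\<close>, cancel in pairs: exchanging
  \<open>p\<close> and \<open>q\<close> and composing \<open>\<sigma>\<close> with their transposition changes only the sign.
\<close>

lemma pf_sum_variation:
  assumes g: "g \<in> orth n"
  shows "(\<Sum>\<sigma> | \<sigma> permutes {1..2 * n}. const (of_int (sign \<sigma>)) *
    (\<Sum>p\<in>{1..2 * n}. \<Sum>k\<in>{1..2 * n}. const (g $$ (k - 1, \<sigma> p - 1)) * pf_word n n (\<sigma>(p := k)))) = 0"
    (is "?L = 0")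
proof -
  let ?I = "{1..2 * n}"
  let ?P = "{\<sigma>. \<sigma> permutes ?I}"
  define F where "F \<sigma> p q = const (of_int (sign \<sigma>)) *
    (const (g $$ (\<sigma> q - 1, \<sigma> p - 1)) * pf_word n n (\<sigma>(p := \<sigma> q)))" for \<sigma> :: "nat \<Rightarrow> nat" and p q
  define H where "H p q = (\<Sum>\<sigma>\<in>?P. F \<sigma> p q)" for p q
  have "?L = (\<Sum>\<sigma>\<in>?P. \<Sum>p\<in>?I. \<Sum>q\<in>?I. F \<sigma> p q)"
  proof (rule sum.cong[OF refl])
    fix \<sigma> assume "\<sigma> \<in> ?P"
    then have "bij_betw \<sigma> ?I ?I" by (simp add: permutes_imp_bij)
    from sum.reindex_bij_betw[OF this, of "\<lambda>k. const (g $$ (k - 1, \<sigma> p - 1)) * pf_word n n (\<sigma>(p := k))" for p]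
    have "(\<Sum>k\<in>?I. const (g $$ (k - 1, \<sigma> p - 1)) * pf_word n n (\<sigma>(p := k))) =
      (\<Sum>q\<in>?I. const (g $$ (\<sigma> q - 1, \<sigma> p - 1)) * pf_word n n (\<sigma>(p := \<sigma> q)))" for p
      by (rule sym)
    then show "const (of_int (sign \<sigma>)) *
      (\<Sum>p\<in>?I. \<Sum>k\<in>?I. const (g $$ (k - 1, \<sigma> p - 1)) * pf_word n n (\<sigma>(p := k))) =
      (\<Sum>p\<in>?I. \<Sum>q\<in>?I. F \<sigma> p q)"
      by (simp add: F_def sum_distrib_left)
  qed
  also have "\<dots> = (\<Sum>p\<in>?I. \<Sum>q\<in>?I. H p q)"
    unfolding H_def by (subst sum.swap) (rule sum.cong[OF refl], rule sum.swap)
  also have "\<dots> = (\<Sum>p\<in>?I. H p p)"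
  proof (rule sum_antisymmetric)
    fix p q assume pq: "p \<in> ?I" "q \<in> ?I" "p \<noteq> q"
    let ?t = "Transposition.transpose p q"
    have t: "?t permutes ?I" using pq by (simp add: permutes_swap_id)
    have "H p q = (\<Sum>\<sigma>\<in>?P. F (\<sigma> \<circ> ?t) p q)"
      unfolding H_def by (rule sum_permutations_compose_right[OF t])
    also have "\<dots> = (\<Sum>\<sigma>\<in>?P. - F \<sigma> q p)"
    proof (rule sum.cong[OF refl])
      fix \<sigma> assume "\<sigma> \<in> ?P"
      then have "permutation \<sigma>" by (auto simp: permutation_permutes)
      then have "sign (\<sigma> \<circ> ?t) = - sign \<sigma>"
        using pq by (simp add: sign_compose permutation_swap_id sign_swap_id)
      moreover have "(\<sigma> \<circ> ?t)(p := \<sigma> p) = \<sigma>(q := \<sigma> p)"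
        by (auto simp: fun_eq_iff Transposition.transpose_def)
      ultimately show "F (\<sigma> \<circ> ?t) p q = - F \<sigma> q p"
        by (simp add: F_def const_simps)
    qed
    finally show "H p q = - H q p" by (simp add: H_def sum_negf)
  qed simp
  also have "\<dots> = (\<Sum>\<sigma>\<in>?P. const (of_int (sign \<sigma>)) *
      (const (\<Sum>p\<in>?I. g $$ (\<sigma> p - 1, \<sigma> p - 1)) * pf_word n n \<sigma>))"
  proof -
    have "const (\<Sum>p\<in>S. f p) = (\<Sum>p\<in>S. const (f p))" for S :: "nat set" and f
      by (induction S rule: infinite_finite_induct) (simp_all add: const_simps)
    then show ?thesis unfolding H_def
      by (subst sum.swap) (simp add: F_def sum_distrib_left sum_distrib_right)
  qed
  also have "\<dots> = 0"
  proof (rule sum.neutral, rule ballI)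
    fix \<sigma> assume "\<sigma> \<in> ?P"
    then have "bij_betw \<sigma> ?I ?I" by (simp add: permutes_imp_bij)
    from sum.reindex_bij_betw[OF this, of "\<lambda>k. g $$ (k - 1, k - 1)"]
    show "const (of_int (sign \<sigma>)) * (const (\<Sum>p\<in>?I. g $$ (\<sigma> p - 1, \<sigma> p - 1)) * pf_word n n \<sigma>) = 0"
      using orth_trace[OF g] by (simp add: const_simps)
  qed
  finally show ?thesis .
qed

lemma gen_pf_sum_commute:
  assumes g: "g \<in> orth n"
  shows "uea_cong n (gen g * pf_sum n) (pf_sum n * gen g)"
proof -
  have "gen g * pf_sum n - pf_sum n * gen g = (\<Sum>\<sigma> | \<sigma> permutes {1..2 * n}.
      const (of_int (sign \<sigma>)) * (gen g * pf_word n n \<sigma> - pf_word n n \<sigma> * gen g))"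
    unfolding pf_sum_def sum_distrib_left sum_distrib_right sum_subtractf[symmetric]
    by (intro sum.cong refl) (simp add: right_diff_distrib mult.assoc[symmetric] const_commute)
  moreover have "uea_cong n \<dots> (\<Sum>\<sigma> | \<sigma> permutes {1..2 * n}. const (of_int (sign \<sigma>)) *
    (\<Sum>p\<in>{1..2 * n}. \<Sum>k\<in>{1..2 * n}. const (g $$ (k - 1, \<sigma> p - 1)) * pf_word n n (\<sigma>(p := k))))"
    by (intro uea_cong_sum uea_cong_mult_left const_closed gen_commutator_pf_word g)
      (simp only: mem_Collect_eq permutes_in_image)
  ultimately show ?thesis unfolding pf_sum_variation[OF g] by (simp add: uea_cong_def)
qed

lemma pf_sum_closed: "pf_sum n \<in> carrier (free_alg n)"
  unfolding pf_sum_def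
  by (intro sum_closed free_closed const_closed pf_word_closed)
    (simp only: mem_Collect_eq permutes_in_image)

lemma centralizer_of_generators:
  assumes z: "z \<in> carrier (free_alg n)"
    and gen: "\<And>g. g \<in> orth n \<Longrightarrow> uea_cong n (gen g * z) (z * gen g)"
    and u: "u \<in> carrier (free_alg n)"
  shows "uea_cong n (u * z) (z * u)"
proof -
  have word: "uea_cong n (Poly_Mapping.single w 1 * z) (z * Poly_Mapping.single w 1)" if "w \<in> lists (orth n)" for w
    using that
  proof (induction w)
    case Nil
    then show ?case using const_simps(1) by (simp add: const_def uea_cong_refl)
  next
    case (Cons g w)
    have split: "Poly_Mapping.single (g # w) 1 = gen g * Poly_Mapping.single w 1"
      by (simp add: gen_def mult_single plus_list_def)
    have w: "Poly_Mapping.single w 1 \<in> carrier (free_alg n)" using Cons.hyps by (simp add: free_alg_def)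
    have "uea_cong n (gen g * (Poly_Mapping.single w 1 * z)) (gen g * (z * Poly_Mapping.single w 1))"
      using Cons by (intro uea_cong_mult_left gen_closed) auto
    also have "gen g * (z * Poly_Mapping.single w 1) = (gen g * z) * Poly_Mapping.single w 1"
      by (simp add: mult.assoc)
    also have "uea_cong n \<dots> ((z * gen g) * Poly_Mapping.single w 1)"
      using Cons w by (intro uea_cong_mult_right gen) auto
    finally show ?case by (simp add: split mult.assoc)
  qed
  have "uea_cong n (Poly_Mapping.single w x * z) (z * Poly_Mapping.single w x)" if "w \<in> lists (orth n)" for w x
  proof -
    have s: "Poly_Mapping.single w x = const x * Poly_Mapping.single w 1"
      by (simp add: const_def mult_single plus_list_def)
    have "uea_cong n (const x * (Poly_Mapping.single w 1 * z)) (const x * (z * Poly_Mapping.single w 1))"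
      by (intro uea_cong_mult_left const_closed word that)
    also have "const x * (z * Poly_Mapping.single w 1) = z * (const x * Poly_Mapping.single w 1)"
      by (simp add: mult.assoc[symmetric] const_commute)
    finally show ?thesis by (simp add: s mult.assoc)
  qed
  moreover have "Poly_Mapping.keys u \<subseteq> lists (orth n)" using u by (simp add: free_alg_def)
  ultimately have "uea_cong n (\<Sum>w\<in>Poly_Mapping.keys u. Poly_Mapping.single w (Poly_Mapping.lookup u w) * z)
      (\<Sum>w\<in>Poly_Mapping.keys u. z * Poly_Mapping.single w (Poly_Mapping.lookup u w))"
    by (intro uea_cong_sum) blast
  then show ?thesis
    unfolding sum_distrib_left[symmetric] sum_distrib_right[symmetric] free_decomp[symmetric] .
qed

section \<open>The Pfaffian as an element of the enveloping algebra\<close>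

text \<open>
  A representative of the Pfaffian in the free algebra.
\<close>

definition pf_free :: "nat \<Rightarrow> free" where
  "pf_free n = const (1 / (2 ^ n * fact n)) * pf_sum n"

lemma pf_free_closed: "pf_free n \<in> carrier (free_alg n)"
  unfolding pf_free_def by (intro free_closed const_closed pf_sum_closed)

lemma uea_class_hom:
  "p \<in> carrier (free_alg n) \<Longrightarrow> q \<in> carrier (free_alg n) \<Longrightarrow>
    uea_class n p \<otimes>\<^bsub>uea n\<^esub> uea_class n q = uea_class n (p * q)"
  "p \<in> carrier (free_alg n) \<Longrightarrow> q \<in> carrier (free_alg n) \<Longrightarrow>
    uea_class n p \<oplus>\<^bsub>uea n\<^esub> uea_class n q = uea_class n (p + q)"
  "\<one>\<^bsub>uea n\<^esub> = uea_class n 1"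
  using ring_hom_mult[OF ideal.rcos_ring_hom[OF ideal_uea_ideal], of p n q]
    ring_hom_add[OF ideal.rcos_ring_hom[OF ideal_uea_ideal], of p n q]
    ring_hom_one[OF ideal.rcos_ring_hom[OF ideal_uea_ideal], of n]
  by (simp_all add: uea_def uea_class_def)

lemma uea_class_zero: "\<zero>\<^bsub>uea n\<^esub> = uea_class n 0"
  using ring_hom_zero[OF ideal.rcos_ring_hom[OF ideal_uea_ideal] ring_free_alg ideal.quotient_is_ring[OF ideal_uea_ideal], of n]
  by (simp add: uea_def uea_class_def)

lemma uea_class_eq:
  assumes "p \<in> carrier (free_alg n)" "q \<in> carrier (free_alg n)" "uea_cong n p q"
  shows "uea_class n p = uea_class n q"
proof -
  interpret R: ring "free_alg n" by (rule ring_free_alg)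
  have "\<ominus>\<^bsub>free_alg n\<^esub> q = - q"
    using assms(2) by (intro R.minus_equality) (auto simp: free_alg_def)
  then have "p \<ominus>\<^bsub>free_alg n\<^esub> q = p - q" by (simp add: a_minus_def)
  then show ?thesis
    using R.quotient_eq_iff_same_a_r_cos[OF ideal_uea_ideal assms(1,2)] assms(3)
    by (simp add: uea_class_def uea_cong_def)
qed

lemma uea_carrierE:
  assumes "u \<in> carrier (uea n)"
  obtains p where "p \<in> carrier (free_alg n)" "u = uea_class n p"
  using assms by (auto simp: uea_def FactRing_def A_RCOSETS_def' uea_class_def)

lemma uea_class_finsum:
  assumes "finite S" "\<And>s. s \<in> S \<Longrightarrow> f s \<in> carrier (free_alg n)"
  shows "(\<Oplus>\<^bsub>uea n\<^esub>s\<in>S. uea_class n (f s)) = uea_class n (\<Sum>s\<in>S. f s)"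
proof -
  interpret U: ring "uea n" by (rule ring_uea)
  show ?thesis using assms
  proof (induction S rule: finite_induct)
    case empty
    then show ?case by (simp add: uea_class_zero)
  next
    case (insert s S)
    then show ?case
      by (subst U.finsum_insert) (auto simp: uea_class_hom sum_closed intro!: uea_class_closed)
  qed
qed

lemma Pf_X_eq: "Pf_X n = uea_class n (pf_free n)"
proof -
  let ?P = "{\<sigma>. \<sigma> permutes {1..2 * n}}"
  have word: "foldr (\<lambda>k u. uea_emb n (X n (\<sigma> (2 * k - 1)) (neg n (\<sigma> (2 * k)))) \<otimes>\<^bsub>uea n\<^esub> u) ks \<one>\<^bsub>uea n\<^esub> =
      uea_class n (prod_list (map (\<lambda>k. gen (Xt n (\<sigma> (2 * k - 1)) (\<sigma> (2 * k)))) ks)) \<and>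
      prod_list (map (\<lambda>k. gen (Xt n (\<sigma> (2 * k - 1)) (\<sigma> (2 * k)))) ks) \<in> carrier (free_alg n)"
    if \<sigma>: "\<sigma> permutes {1..2 * n}" and ks: "set ks \<subseteq> {1..n}" for \<sigma> ks
    using ks
  proof (induction ks)
    case Nil
    show ?case by (simp add: uea_class_hom one_closed)
  next
    case (Cons k ks)
    then have "2 * k - 1 \<in> {1..2 * n}" "2 * k \<in> {1..2 * n}" by auto
    then have "Xt n (\<sigma> (2 * k - 1)) (\<sigma> (2 * k)) \<in> orth n"
      by (intro Xt_orth) (simp_all only: permutes_in_image[OF \<sigma>])
    then show ?case
      using Cons by (simp add: uea_emb_def uea_class_hom gen_closed free_closed Xt_def[symmetric])
  qed
  have "(\<Oplus>\<^bsub>uea n\<^esub>\<sigma>\<in>?P. uea_smult n (of_int (sign \<sigma>))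
      (foldr (\<lambda>k u. uea_emb n (X n (\<sigma> (2 * k - 1)) (neg n (\<sigma> (2 * k)))) \<otimes>\<^bsub>uea n\<^esub> u) [1..<n + 1] \<one>\<^bsub>uea n\<^esub>)) =
    (\<Oplus>\<^bsub>uea n\<^esub>\<sigma>\<in>?P. uea_class n (const (of_int (sign \<sigma>)) * pf_word n n \<sigma>))"
  proof -
    interpret U: ring "uea n" by (rule ring_uea)
    have eq: "uea_smult n (of_int (sign \<sigma>))
      (foldr (\<lambda>k u. uea_emb n (X n (\<sigma> (2 * k - 1)) (neg n (\<sigma> (2 * k)))) \<otimes>\<^bsub>uea n\<^esub> u) [1..<n + 1] \<one>\<^bsub>uea n\<^esub>) =
      uea_class n (const (of_int (sign \<sigma>)) * pf_word n n \<sigma>)"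
      and cl: "const (of_int (sign \<sigma>)) * pf_word n n \<sigma> \<in> carrier (free_alg n)" if "\<sigma> \<in> ?P" for \<sigma>
    proof -
      have \<sigma>: "\<sigma> permutes {1..2 * n}" using that by simp
      have ks: "set [1..<n + 1] \<subseteq> {1..n}" by auto
      note w = word[OF \<sigma> ks, folded pf_word_def]
      show "uea_smult n (of_int (sign \<sigma>))
        (foldr (\<lambda>k u. uea_emb n (X n (\<sigma> (2 * k - 1)) (neg n (\<sigma> (2 * k)))) \<otimes>\<^bsub>uea n\<^esub> u) [1..<n + 1] \<one>\<^bsub>uea n\<^esub>) =
        uea_class n (const (of_int (sign \<sigma>)) * pf_word n n \<sigma>)"
        unfolding conjunct1[OF w] uea_smult_def by (rule uea_class_hom(1)[OF const_closed conjunct2[OF w]])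
      show "const (of_int (sign \<sigma>)) * pf_word n n \<sigma> \<in> carrier (free_alg n)"
        by (intro free_closed const_closed conjunct2[OF w])
    qed
    show ?thesis
      by (rule U.finsum_cong') (auto simp only: eq intro!: uea_class_closed cl)
  qed
  also have "\<dots> = uea_class n (pf_sum n)"
    unfolding pf_sum_def
    by (intro uea_class_finsum finite_permutations free_closed const_closed pf_word_closed)
      (simp_all only: mem_Collect_eq permutes_in_image finite_atLeastAtMost)
  finally show ?thesis
    unfolding Pf_X_def pfaffian_def pf_free_def
    by (simp only: uea_smult_def uea_class_hom(1)[OF const_closed pf_sum_closed])
qed

lemma gen_pf_free_commute:
  assumes g: "g \<in> orth n"
  shows "uea_cong n (gen g * pf_free n) (pf_free n * gen g)"
proof -
  have "uea_cong n (const (1 / (2 ^ n * fact n)) * (gen g * pf_sum n)) (const (1 / (2 ^ n * fact n)) * (pf_sum n * gen g))"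
    by (intro uea_cong_mult_left const_closed gen_pf_sum_commute g)
  then show ?thesis
    by (simp add: pf_free_def mult.assoc[symmetric] const_commute)
qed

theorem Pf_X_central: "Pf_X n \<in> uea_center n"
proof -
  note comm = centralizer_of_generators[OF pf_free_closed gen_pf_free_commute]
  show ?thesis
    unfolding uea_center_def Pf_X_eq mem_Collect_eq
  proof (intro conjI ballI)
    fix u assume "u \<in> carrier (uea n)"
    then obtain p where p: "p \<in> carrier (free_alg n)" "u = uea_class n p" by (rule uea_carrierE)
    show "uea_class n (pf_free n) \<otimes>\<^bsub>uea n\<^esub> u = u \<otimes>\<^bsub>uea n\<^esub> uea_class n (pf_free n)"
      unfolding p(2) uea_class_hom(1)[OF pf_free_closed p(1)] uea_class_hom(1)[OF p(1) pf_free_closed]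
      by (rule uea_class_eq[symmetric]) (intro free_closed pf_free_closed p(1) comm)+
  qed (rule uea_class_closed[OF pf_free_closed])
qed

section \<open>A model on functions with values in a representation\<close>

text \<open>
  The additive endomorphisms of an abelian group.  The sort is not that of rings with \<open>0 \<noteq> 1\<close> because the
  group may be trivial.
\<close>

typedef (overloaded) 'v endo = "{f :: 'v::ab_group_add \<Rightarrow> 'v. \<forall>x y. f (x + y) = f x + f y}"
  morphisms app Endo
  by (rule exI[of _ id]) simp

setup_lifting type_definition_endo

instantiation endo :: (ab_group_add) "{ring, monoid_mult}"
begin
lift_definition zero_endo :: "'a endo" is "\<lambda>_. 0" by simp
lift_definition one_endo :: "'a endo" is "\<lambda>x. x" by simp
lift_definition plus_endo :: "'a endo \<Rightarrow> 'a endo \<Rightarrow> 'a endo" is "\<lambda>f g x. f x + g x"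
  by (simp add: algebra_simps)
lift_definition minus_endo :: "'a endo \<Rightarrow> 'a endo \<Rightarrow> 'a endo" is "\<lambda>f g x. f x - g x"
  by (simp add: algebra_simps)
lift_definition uminus_endo :: "'a endo \<Rightarrow> 'a endo" is "\<lambda>f x. - f x"
  by (simp add: algebra_simps)
lift_definition times_endo :: "'a endo \<Rightarrow> 'a endo \<Rightarrow> 'a endo" is "\<lambda>f g x. f (g x)"
  by simp
instance
  by standard (transfer; simp add: fun_eq_iff algebra_simps)+
end

lemma app_simps [simp]: "app 0 F = 0" "app 1 F = F" "app (x + y) F = app x F + app y F"
  "app (- x) F = - app x F" "app (x - y) F = app x F - app y F" "app (x * y) F = app x (app y F)"
  by (transfer; simp)+

lemma endo_eqI: "(\<And>F. app x F = app y F) \<Longrightarrow> x = y"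
  by transfer auto

lemma app_sum: "app (\<Sum>s\<in>S. f s) F = (\<Sum>s\<in>S. app (f s) F)"
  by (induction S rule: infinite_finite_induct) simp_all

text \<open>
  A function on finite sets of indices with values in \<open>'v\<close> is an element of the exterior algebra tensored
  with \<open>'v\<close>; the value at a set is the coefficient of the product of its \<open>e\<^sub>i\<close> in increasing order.  \<open>wedge i\<close> is left
  multiplication by \<open>e\<^sub>i\<close>, and \<open>pointwise f\<close> is \<open>f\<close> acting on the coefficients.  Infinite sets occur as
  arguments too, but play no role.
\<close>

lift_definition wedge :: "nat \<Rightarrow> (nat set \<Rightarrow> 'v::ab_group_add) endo" is
  "\<lambda>i F S. if i \<in> S then (if even (card {j \<in> S. j < i}) then F (S - {i}) else - F (S - {i})) else 0"
  by (auto simp: fun_eq_iff)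

definition pointwise :: "('v::ab_group_add \<Rightarrow> 'v) \<Rightarrow> (nat set \<Rightarrow> 'v) endo" where
  "pointwise f = Endo (\<lambda>F S. f (F S))"

lemma app_pointwise:
  assumes "\<And>x y. f (x + y) = f x + f y"
  shows "app (pointwise f) F S = f (F S)"
  unfolding pointwise_def by (subst Endo_inverse) (auto simp: assms fun_eq_iff)

lemma wedge_square: "wedge i * wedge i = 0"
  by (intro endo_eqI ext) (simp add: wedge.rep_eq)

lemma wedge_anticommute:
  "(wedge i * wedge j :: (nat set \<Rightarrow> 'v::ab_group_add) endo) = - (wedge j * wedge i)"
proof -
  have less: "(wedge i * wedge j :: (nat set \<Rightarrow> 'v) endo) = - (wedge j * wedge i)" if "i < j" for i j
  proof (intro endo_eqI ext)
    fix F :: "nat set \<Rightarrow> 'v" and S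
    show "app (wedge i * wedge j) F S = app (- (wedge j * wedge i)) F S"
    proof (cases "i \<in> S \<and> j \<in> S")
      case True
      have "{k \<in> S. k < j} = insert i {k \<in> S - {i}. k < j}" using that True by auto
      then have "card {k \<in> S. k < j} = Suc (card {k \<in> S - {i}. k < j})" by simp
      moreover have "{k \<in> S - {j}. k < i} = {k \<in> S. k < i}" using that by auto
      moreover have "S - {i} - {j} = S - {j} - {i}" by auto
      ultimately show ?thesis using True that by (simp add: wedge.rep_eq)
    next
      case False
      then show ?thesis by (auto simp: wedge.rep_eq)
    qed
  qed
  show ?thesis
  proof (cases i j rule: linorder_cases)
    case equal
    then show ?thesis by (simp add: wedge_square)
  qed (use less[of i j] less[of j i] in simp_all)
qed

lemma wedge_pointwise:
  assumes "\<And>x y. f (x + y) = f x + f y"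
  shows "pointwise f * wedge i = wedge i * pointwise f"
proof (intro endo_eqI ext)
  have "f 0 + f 0 = f 0" using assms[of 0 0] by simp
  then have "f 0 = 0" by simp
  moreover then have "f (- x) = - f x" for x
    using assms[of x "- x"] by (simp add: eq_neg_iff_add_eq_0 add.commute)
  ultimately show "app (pointwise f * wedge i) F S = app (wedge i * pointwise f) F S" for F S
    by (simp add: app_pointwise[OF assms] wedge.rep_eq)
qed

text \<open>
  The coefficient of \<open>e\<^sub>k \<cdots> e\<^sub>N\<close> in the product of \<open>e\<^sub>k \<cdots> e\<^sub>N\<close> with \<open>F\<close> is that of \<open>F\<close> in degree
  zero.
\<close>

lemma app_wedges: "k \<le> N + 1 \<Longrightarrow> app (prod_list (map wedge [k..<N + 1])) F {k..N} = F {}"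
proof (induction rule: inc_induct)
  case base
  then show ?case by simp
next
  case (step k)
  have "{j \<in> {k..N}. j < k} = {}" "{k..N} - {k} = {Suc k..N}" "k \<in> {k..N}" using step(2) by auto
  then have "app (wedge k) G {k..N} = G {Suc k..N}" for G :: "nat set \<Rightarrow> 'a"
    by (simp only: wedge.rep_eq if_True card.empty even_zero)
  moreover have "[k..<N + 1] = k # [Suc k..<N + 1]" using step(2) by (simp add: upt_conv_Cons del: upt_Suc)
  ultimately show ?case using step by (simp del: upt_Suc)
qed

section \<open>The action on a highest weight vector\<close>

lemma Xt_flip:
  assumes "i \<in> {1..2 * n}" "j \<in> {1..2 * n}"
  shows "Xt n j i = (- 1) \<cdot>\<^sub>m Xt n i j"
  using Xt_orth[OF assms] Xt_orth[OF assms(2,1)] Xt_entry[OF assms(1)] Xt_entry[OF assms(2)]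
  by (intro eq_matI) (auto dest!: orth_carrier)

context
  fixes n :: nat and scale :: "complex \<Rightarrow> 'v::ab_group_add \<Rightarrow> 'v" and \<rho>
  assumes rep: "orth_rep n scale \<rho>"
begin

interpretation vector_space scale using rep by (simp add: orth_rep_def)

lemma rep_add: "x \<in> orth n \<Longrightarrow> \<rho> x (u + w) = \<rho> x u + \<rho> x w"
  using rep_linear[OF rep] by (simp add: Vector_Spaces.linear_iff)

lemma rep_scale: "x \<in> orth n \<Longrightarrow> \<rho> x (scale z u) = scale z (\<rho> x u)"
  using rep_linear[OF rep] by (simp add: Vector_Spaces.linear_iff)

lemma free_act_gen: "free_act scale \<rho> (gen x) u = \<rho> x u"
  by (simp add: gen_def free_act_single[OF rep])

lemma free_act_const: "free_act scale \<rho> (const z) u = scale z u"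
  by (simp add: const_def free_act_single[OF rep])

lemma free_act_cong: "uea_cong n p q \<Longrightarrow> free_act scale \<rho> p u = free_act scale \<rho> q u"
  using free_act_ideal[OF rep, of "p - q" u] by (simp add: uea_cong_def free_act_diff[OF rep])

lemma rep_commutator:
  assumes i: "i \<in> {1..2 * n}" and j: "j \<in> {1..2 * n}" and k: "k \<in> {1..2 * n}" and l: "l \<in> {1..2 * n}"
  shows "\<rho> (Xt n i j) (\<rho> (Xt n k l) u) - \<rho> (Xt n k l) (\<rho> (Xt n i j) u) =
    (if k = neg n j then \<rho> (Xt n i l) u else 0) - (if k = neg n i then \<rho> (Xt n j l) u else 0) +
    (if l = neg n j then \<rho> (Xt n k i) u else 0) - (if l = neg n i then \<rho> (Xt n k j) u else 0)"
proof -
  have entry: "Xt n i j $$ (m - 1, k - 1) = of_bool (m = i \<and> k = neg n j) - of_bool (m = j \<and> k = neg n i)"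
    if m: "m \<in> {1..2 * n}" and k: "k \<in> {1..2 * n}" for m k
  proof -
    have "m - 1 < 2 * n" "k - 1 < 2 * n" "m - 1 + 1 = m" "k - 1 + 1 = k" using m k by auto
    moreover have "neg n k = j \<longleftrightarrow> k = neg n j" "neg n k = i \<longleftrightarrow> k = neg n i"
      using i j k by (auto simp: neg_def)
    ultimately show ?thesis using Xt_entry[OF j, of "m - 1" "k - 1" i] by simp
  qed
  have sum: "(\<Sum>m\<in>{1..2 * n}. scale (Xt n i j $$ (m - 1, k - 1)) (f m)) =
    (if k = neg n j then f i else 0) - (if k = neg n i then f j else 0)"
    if k: "k \<in> {1..2 * n}" for k and f :: "nat \<Rightarrow> 'v"
  proof -
    have "(\<Sum>m\<in>{1..2 * n}. scale (Xt n i j $$ (m - 1, k - 1)) (f m)) =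
      (\<Sum>m\<in>{1..2 * n}. (if m = i then if k = neg n j then f i else 0 else 0) -
        (if m = j then if k = neg n i then f j else 0 else 0))"
    proof (rule sum.cong[OF refl])
      fix m assume "m \<in> {1..2 * n}"
      from entry[OF this k] show "scale (Xt n i j $$ (m - 1, k - 1)) (f m) =
        (if m = i then if k = neg n j then f i else 0 else 0) -
        (if m = j then if k = neg n i then f j else 0 else 0)"
        by (auto simp: scale_left_diff_distrib)
    qed
    then show ?thesis using i j by (simp add: sum_subtractf)
  qed
  have o: "Xt n i j \<in> orth n" "Xt n k l \<in> orth n" by (intro Xt_orth i j k l)+
  have "\<rho> (Xt n i j) (\<rho> (Xt n k l) u) - \<rho> (Xt n k l) (\<rho> (Xt n i j) u) =
      free_act scale \<rho> (gen (Xt n i j) * gen (Xt n k l) - gen (Xt n k l) * gen (Xt n i j)) u"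
    by (simp add: free_act_diff[OF rep] free_act_mult[OF rep] gen_closed o free_act_gen)
  also have "\<dots> = (\<Sum>m\<in>{1..2 * n}. scale (Xt n i j $$ (m - 1, k - 1)) (\<rho> (Xt n m l) u)) +
      (\<Sum>m\<in>{1..2 * n}. scale (Xt n i j $$ (m - 1, l - 1)) (\<rho> (Xt n k m) u))"
    unfolding free_act_cong[OF gen_commutator_Xt[OF o(1) k l]]
    by (simp add: free_act_sum[OF rep] free_act_add[OF rep] free_act_mult[OF rep const_closed]
        free_act_const free_act_gen sum.distrib)
  finally show ?thesis unfolding sum[OF k] sum[OF l] by simp
qed

text \<open>
  Both sides are obtained from \<open>\<Omega>\<^sup>n v\<close> as the coefficient of \<open>e\<^sub>1 \<cdots> e\<^sub>2\<^sub>n\<close>, where \<open>\<Omega>\<close> is \<open>Omega {1..2 * n}\<close>.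
\<close>

lemma highest_weight_pf_sum:
  assumes cartan: "\<And>h. h \<in> cartan n \<Longrightarrow> \<rho> h v = scale (\<Sum>i=1..n. l i * eps i h) v"
    and raising: "\<And>x. x \<in> positive_root_vectors n \<Longrightarrow> \<rho> x v = 0"
  shows "free_act scale \<rho> (pf_sum n) v =
    scale (2 ^ n * fact n * (\<Prod>i=1..n. l i + of_nat n - of_nat i)) v"
proof -
  \<comment> \<open>Zero out of range, so that the commutation rules without index conditions hold throughout.\<close>
  define A :: "nat \<Rightarrow> nat \<Rightarrow> (nat set \<Rightarrow> 'v) endo" where
    "A i j = (if i \<in> {1..2 * n} \<and> j \<in> {1..2 * n} then pointwise (\<rho> (Xt n i j)) else 0)" for i j
  define c :: "complex \<Rightarrow> (nat set \<Rightarrow> 'v) endo" where "c z = pointwise (scale z)" for z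
  \<comment> \<open>\<open>v\<close> in exterior degree zero\<close>
  define vac :: "nat set \<Rightarrow> 'v" where "vac S = (if S = {} then v else 0)" for S
  define ev where "ev x = app x vac" for x :: "(nat set \<Rightarrow> 'v) endo"
  have A: "app (A i j) F S = \<rho> (Xt n i j) (F S)" if "i \<in> {1..2 * n}" "j \<in> {1..2 * n}" for i j F S
    using that by (simp add: A_def app_pointwise rep_add Xt_orth)
  have A0: "A i j = 0" if "\<not> (i \<in> {1..2 * n} \<and> j \<in> {1..2 * n})" for i j
    using that by (simp only: A_def if_False)
  have c: "app (c z) F S = scale z (F S)" for z F S
    by (simp add: c_def app_pointwise scale_right_distrib)
  have rep_zero: "\<rho> x 0 = 0" if "x \<in> orth n" for x
    using rep_scale[OF that, of 0 0] by simp
  interpret orth_highest_weight wedge n A c ev l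
  proof
    show "wedge i * wedge j = - (wedge j * wedge i)" for i j :: nat by (rule wedge_anticommute)
    show "wedge i * wedge i = 0" for i by (rule wedge_square)
    show "c (x + y) = c x + c y" "c (x * y) = c x * c y" "c 1 = 1" for x y
      by (intro endo_eqI ext, simp add: c scale_left_distrib)+
    show "wedge i * c x = c x * wedge i" for i x
      unfolding c_def by (rule wedge_pointwise[symmetric]) (rule scale_right_distrib)
    show "A i j * c x = c x * A i j" for i j x
    proof (cases "i \<in> {1..2 * n} \<and> j \<in> {1..2 * n}")
      case True
      then show ?thesis by (intro endo_eqI ext) (simp add: A c rep_scale Xt_orth)
    qed (simp add: A0)
    show "A k l * wedge i = wedge i * A k l" for i k l
      by (auto simp: A_def intro!: wedge_pointwise rep_add Xt_orth)
    show "A j i = - A i j" for i j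
    proof (cases "i \<in> {1..2 * n} \<and> j \<in> {1..2 * n}")
      case True
      then have "\<rho> (Xt n j i) u = - \<rho> (Xt n i j) u" for u
        using rep Xt_orth[of i n j] by (simp add: Xt_flip[of i n j] orth_rep_def)
      then show ?thesis using True by (intro endo_eqI ext) (simp add: A)
    qed (use A0[of i j] A0[of j i] in auto)
    show "A i j * A k l - A k l * A i j =
        (if k = neg n j then A i l else 0) - (if k = neg n i then A j l else 0) +
        (if l = neg n j then A k i else 0) - (if l = neg n i then A k j else 0)"
      if "i \<in> {1..2 * n}" "j \<in> {1..2 * n}" "k \<in> {1..2 * n}" "l \<in> {1..2 * n}" for i j k l
    proof (intro endo_eqI ext)
      fix F :: "nat set \<Rightarrow> 'v" and S
      have if_app: "app (if b then x else 0) F S = (if b then app x F S else 0)" for b x by simp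
      show "app (A i j * A k l - A k l * A i j) F S = app ((if k = neg n j then A i l else 0) -
        (if k = neg n i then A j l else 0) + (if l = neg n j then A k i else 0) -
        (if l = neg n i then A k j else 0)) F S"
        using rep_commutator[OF that, of "F S"] that
        by (simp only: app_simps minus_apply plus_fun_apply if_app A)
    qed
    show "ev (x + y) = ev x + ev y" for x y by (simp add: ev_def)
    show "ev y = ev y' \<Longrightarrow> ev (x * y) = ev (x * y')" for x y y' by (simp add: ev_def)
    show "ev (A i j) = 0" if ij: "1 \<le> i" "i < j" "j \<le> 2 * n - i" for i j
    proof -
      have r: "i \<in> {1..2 * n}" "j \<in> {1..2 * n}" using ij by auto
      have "Xt n i j \<in> positive_root_vectors n"
      proof (cases "j \<le> n")
        case True
        then show ?thesis using ij by (auto simp: positive_root_vectors_def Xt_def)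
      next
        case False
        then have "i < neg n j" "neg n j \<le> n" using ij by (auto simp: neg_def)
        then show ?thesis using ij by (auto simp: positive_root_vectors_def Xt_def)
      qed
      then show ?thesis using raising
        by (intro ext) (simp add: ev_def A[OF r] vac_def rep_zero[OF Xt_orth[OF r]])
    qed
    show "ev (A i (neg n i)) = ev (c (l i))" if i: "1 \<le> i" "i \<le> n" for i
    proof -
      have r: "i \<in> {1..2 * n}" "neg n i \<in> {1..2 * n}" using i by (auto simp: neg_def)
      have entry: "Xt n i (neg n i) $$ (a, b) =
          of_bool (a + 1 = i \<and> b + 1 = i) - of_bool (a + 1 = neg n i \<and> b + 1 = neg n i)"
        if ab: "a < 2 * n" "b < 2 * n" for a b
      proof -
        have "neg n (b + 1) = neg n i \<longleftrightarrow> b + 1 = i" "neg n (b + 1) = i \<longleftrightarrow> b + 1 = neg n i"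
          using ab r by (auto simp: neg_def)
        then show ?thesis using Xt_entry[OF r(2) ab, of i] by simp
      qed
      have "Xt n i (neg n i) \<in> cartan n"
        using Xt_orth[OF r] orth_carrier[OF Xt_orth[OF r]]
        by (auto simp: cartan_def diagonal_mat_def entry)
      moreover have "(\<Sum>j=1..n. l j * eps j (Xt n i (neg n i))) = (\<Sum>j=1..n. if j = i then l i else 0)"
      proof (rule sum.cong[OF refl])
        fix j assume "j \<in> {1..n}"
        then have "j - 1 < 2 * n" "j - 1 + 1 = j" "j \<noteq> neg n i" using i by (auto simp: neg_def)
        then show "l j * eps j (Xt n i (neg n i)) = (if j = i then l i else 0)"
          unfolding eps_def by (subst entry) auto
      qed
      ultimately have "\<rho> (Xt n i (neg n i)) v = scale (l i) v"
        using cartan[of "Xt n i (neg n i)"] i by simp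
      then show ?thesis
        by (intro ext) (simp add: ev_def A[OF r] c vac_def rep_zero[OF Xt_orth[OF r]])
    qed
  qed
  have word: "app (word n \<sigma>) vac {} = free_act scale \<rho> (pf_word n n \<sigma>) v"
    if \<sigma>: "\<sigma> permutes {1..2 * n}" for \<sigma>
  proof -
    have "app (prod_list (map (\<lambda>k. A (\<sigma> (2 * k - 1)) (\<sigma> (2 * k))) ks)) vac {} =
      free_act scale \<rho> (prod_list (map (\<lambda>k. gen (Xt n (\<sigma> (2 * k - 1)) (\<sigma> (2 * k)))) ks)) v"
      if "set ks \<subseteq> {1..n}" for ks
      using that
    proof (induction ks)
      case Nil
      show ?case using free_act_const[of 1 v] by (simp add: vac_def const_simps)
    next
      case (Cons k ks)
      then have "2 * k - 1 \<in> {1..2 * n}" "2 * k \<in> {1..2 * n}" by auto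
      then have k: "\<sigma> (2 * k - 1) \<in> {1..2 * n}" "\<sigma> (2 * k) \<in> {1..2 * n}"
        by (simp_all only: permutes_in_image[OF \<sigma>])
      have "set ks \<subseteq> {1..n}" using Cons.prems by simp
      note IH = Cons.IH[OF this]
      show ?case
        by (simp only: list.map prod_list.Cons app_simps A[OF k] IH
            free_act_mult[OF rep gen_closed[OF Xt_orth[OF k]]] free_act_gen)
    qed
    moreover have "set [1..<n + 1] \<subseteq> {1..n}" by auto
    ultimately show ?thesis unfolding word_def pf_word_def by blast
  qed
  have top: "app (eprod [1..<2 * n + 1] * x) vac {1..2 * n} = app x vac {}" for x
    using app_wedges[of 1 "2 * n" "app x vac"] by (simp add: eprod_def del: upt_Suc)
  have top1: "app (eprod [1..<2 * n + 1]) vac {1..2 * n} = v"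
    using top[of 1] by (simp only: mult_1_right app_simps vac_def) simp
  have sum_apply: "(\<Sum>s\<in>S. f s) T = (\<Sum>s\<in>S. f s T)" for f :: "(nat \<Rightarrow> nat) \<Rightarrow> nat set \<Rightarrow> 'v" and S T
    by (induction S rule: infinite_finite_induct) simp_all
  from fun_cong[OF ev_pfaffian_sum, of "{1..2 * n}"]
  have "(\<Sum>\<sigma> | \<sigma> permutes {1..2 * n}. scale (of_int (sign \<sigma>)) (app (word n \<sigma>) vac {})) =
      scale (2 ^ n * fact n * (\<Prod>i=1..n. l i + of_nat n - of_nat i)) v"
    unfolding ev_def
    by (simp only: app_sum sum_apply app_simps(6)[of "c _"] c top top1)
  then show ?thesis
    by (simp add: pf_sum_def free_act_sum[OF rep] free_act_mult[OF rep const_closed] free_act_const word)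
qed

end

section \<open>The eigenvalue of the Pfaffian\<close>

theorem corollary4p8:
  fixes n :: nat
    and scale :: "complex \<Rightarrow> 'v::ab_group_add \<Rightarrow> 'v"
    and \<rho> :: "complex mat \<Rightarrow> 'v \<Rightarrow> 'v"
    and l :: "nat \<Rightarrow> complex"
  assumes "n \<ge> 1"
    and "irreducible_orth_rep n scale \<rho>"
    and "has_highest_weight n scale \<rho> (\<lambda>h. \<Sum>i=1..n. l i * eps i h)"
  shows "Pf_X n \<in> uea_center n \<and>
         (\<forall>v. uea_act scale \<rho> (Pf_X n) v = scale (\<Prod>i=1..n. l i + of_nat n - of_nat i) v)"
proof
  show "Pf_X n \<in> uea_center n" by (rule Pf_X_central)
  have rep: "orth_rep n scale \<rho>" using assms(2) by (simp add: irreducible_orth_rep_def)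
  interpret vector_space scale using rep by (simp add: orth_rep_def)
  let ?P = "free_act scale \<rho> (pf_free n)"
  let ?k = "\<Prod>i=1..n. l i + of_nat n - of_nat i"
  obtain v where v: "v \<noteq> 0" "\<And>h. h \<in> cartan n \<Longrightarrow> \<rho> h v = scale (\<Sum>i=1..n. l i * eps i h) v"
    "\<And>x. x \<in> positive_root_vectors n \<Longrightarrow> \<rho> x v = 0"
    using assms(3) unfolding has_highest_weight_def by blast
  have "free_act scale \<rho> (pf_sum n) v = scale (2 ^ n * fact n * ?k) v"
    by (rule highest_weight_pf_sum[OF rep]) (use v in auto)
  then have Pv: "?P v = scale ?k v"
    unfolding pf_free_def free_act_mult[OF rep const_closed] free_act_const[OF rep] by simp
  \<comment> \<open>The eigenspace is a nonzero invariant subspace, hence everything.\<close>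
  define W where "W = {u. ?P u = scale ?k u}"
  have lin: "?P (u + w) = ?P u + ?P w" "?P (scale z u) = scale z (?P u)" for u w z
  proof -
    have word: "foldr \<rho> ws (u + w) = foldr \<rho> ws u + foldr \<rho> ws w" "foldr \<rho> ws (scale z u) = scale z (foldr \<rho> ws u)"
      if "ws \<in> Poly_Mapping.keys (pf_free n)" for ws
      using word_linear[OF rep, of ws] that pf_free_closed[of n]
      by (auto simp: Vector_Spaces.linear_iff free_alg_def)
    show "?P (u + w) = ?P u + ?P w" "?P (scale z u) = scale z (?P u)"
      by (simp_all add: free_act_def word scale_right_distrib sum.distrib scale_sum_right mult.commute)
  qed
  have "module.subspace scale W"
  proof (rule subspaceI)
    show "0 \<in> W" using lin(2)[of 0 0] by (simp add: W_def)
  qed (auto simp: W_def lin scale_right_distrib mult.commute)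
  moreover have "\<rho> x ` W \<subseteq> W" if x: "x \<in> orth n" for x
  proof
    fix y assume "y \<in> \<rho> x ` W"
    then obtain u where u: "?P u = scale ?k u" "y = \<rho> x u" by (auto simp: W_def)
    have "?P y = free_act scale \<rho> (gen x * pf_free n) u"
      using free_act_cong[OF rep gen_pf_free_commute[OF x], of u]
      by (simp add: u(2) free_act_mult[OF rep] pf_free_closed free_act_gen[OF rep])
    also have "\<dots> = scale ?k y"
      by (simp add: u free_act_mult[OF rep] gen_closed x free_act_gen[OF rep] rep_scale[OF rep x])
    finally show "y \<in> W" by (simp add: W_def)
  qed
  moreover have "v \<in> W" using Pv by (simp add: W_def)
  ultimately have "W = UNIV" using assms(2) v(1) unfolding irreducible_orth_rep_def by blast
  then show "\<forall>v. uea_act scale \<rho> (Pf_X n) v = scale ?k v"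
    unfolding Pf_X_eq uea_act_class[OF rep pf_free_closed] W_def by blast
qed

end
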